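(* Let $\mu_N$ be the Curie--Weiss measure on $\{-1,+1\}^N$ at $\beta=1$, $h=0$, and for integers $1\le k\le N$ let $p_{N,k}(j)=\mu_N(\mathcal P_k=j)$, $j=0,\dots,k$, where $\mathcal P_k$ is the number of indices $i\in\{1,\dots,k\}$ with $\sigma_i=+1$. For every $\varepsilon>0$ there exists $N_\varepsilon<\infty$ such that, for all $N\ge N_\varepsilon$, the following statements hold: (1) If $k\le\left(\frac12-\varepsilon\right)N$, then the distribution $(p_{N,k}(j))_{j=0}^k$ is log-concave and hence unimodal. (2) If $k\ge\left(\frac12+\varepsilon\right)N$ (with $k\le N$), then the distribution $(p_{N,k}(j))_{j=0}^k$ is not unimodal.
   Context: For $\beta=1$ and $h=0$ the Curie--Weiss measure on $\{-1,+1\}^N$ is $$\mu_N(\sigma)=\frac1{Z_N}\exp\left(\frac1{2N}\Big(\sum_{i=1}^N\sigma_i\Big)^2\right),$$ where $Z_N$ is the normalizing constant. A positive sequence $(p(j))_{j=0}^k$ is log-concave if $p(j)^2\ge p(j-1)p(j+1)$ for all $1\le j\le k-1$. It is unimodal if there is an index $m$ such that $p$ is non-decreasing on $\{0,\dots,m\}$ and non-increasing on $\{m,\dots,k\}$. *)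

theory Defs
  imports "HOL-Analysis.Analysis"
begin

(* {-1,+1}^N as extensional functions on {1..N}, so that distinct elements differ on {1..N}. *)
definition spin_configs :: "nat \<Rightarrow> (nat \<Rightarrow> real) set" where
  "spin_configs N = {1..N} \<rightarrow>\<^sub>E {-1, 1}"

definition cw_weight :: "nat \<Rightarrow> (nat \<Rightarrow> real) \<Rightarrow> real" where
  "cw_weight N \<sigma> = exp (1 / (2 * real N) * (\<Sum>i=1..N. \<sigma> i)\<^sup>2)"

definition cw_partition :: "nat \<Rightarrow> real" where
  "cw_partition N = (\<Sum>\<sigma>\<in>spin_configs N. cw_weight N \<sigma>)"

(* Inverse temperature 1, no external field. *)
definition curie_weiss :: "nat \<Rightarrow> (nat \<Rightarrow> real) measure" where
  "curie_weiss N =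
     point_measure (spin_configs N) (\<lambda>\<sigma>. ennreal (cw_weight N \<sigma> / cw_partition N))"

definition plus_count :: "nat \<Rightarrow> (nat \<Rightarrow> real) \<Rightarrow> nat" where
  "plus_count k \<sigma> = card {i \<in> {1..k}. \<sigma> i = 1}"

definition plus_prob :: "nat \<Rightarrow> nat \<Rightarrow> nat \<Rightarrow> real" where
  "plus_prob N k j =
     measure (curie_weiss N) {\<sigma> \<in> space (curie_weiss N). plus_count k \<sigma> = j}"

(* Both predicates concern the finite sequence p 0, ..., p k only.
   Log-concavity includes positivity. *)
definition log_concave_seq :: "nat \<Rightarrow> (nat \<Rightarrow> real) \<Rightarrow> bool" where
  "log_concave_seq k p \<longleftrightarrow>
     (\<forall>j\<le>k. 0 < p j) \<and> (\<forall>j\<in>{1..<k}. p (j - 1) * p (j + 1) \<le> (p j)\<^sup>2)"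

definition unimodal_seq :: "nat \<Rightarrow> (nat \<Rightarrow> real) \<Rightarrow> bool" where
  "unimodal_seq k p \<longleftrightarrow>
     (\<exists>m\<le>k. mono_on {0..m} p \<and> antimono_on {m..k} p)"

end

theory Submission
  imports Defs "HOL-Probability.Distributions" "HOL-Real_Asymp.Real_Asymp"
begin

text \<open>
  Summing out the last \<open>n = N - k\<close> spins one at a time gives, up to a constant,
  \<open>p\<^sub>N\<^sub>,\<^sub>k(j) = (k choose j) w(2j - k)\<close>, where \<open>w(s)\<close> is the average of
  \<open>exp ((s + S\<^sub>n)\<^sup>2 / 2N)\<close> over a simple random walk \<open>S\<^sub>n\<close> (\<open>plus_prob_eq\<close>). Writing
  \<open>exp (x\<^sup>2 / 2N)\<close> as a Gaussian average of \<open>exp (x y)\<close> turns this into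
  \<open>w(s) = const \<cdot> \<integral> exp (- k y\<^sup>2 / 2) \<psi>(y) exp (s y) dy\<close> with
  \<open>\<psi>(y) = (cosh y \<cdot> exp (- y\<^sup>2 / 2))\<^sup>n\<close>, which is \<open>exp (- n y\<^sup>4 / 12)\<close> to leading order
  (\<open>cw_average_gauss\<close>).

  With \<open>s = 2j - k\<close>, log-concavity at \<open>j\<close> says
  \<open>(k\<^sup>2 - s\<^sup>2) w(s + 2) w(s - 2) \<le> ((k + 2)\<^sup>2 - s\<^sup>2) w(s)\<^sup>2\<close>. At \<open>s = 0\<close> the binomial coefficients
  leave room for \<open>w(2) w(-2) / w(0)\<^sup>2\<close> up to \<open>(1 + 2/k)\<^sup>2 = 1 + 4/k + 4/k\<^sup>2\<close>, whereas a purely Gaussian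
  integrand gives \<open>exp (4/k) = 1 + 4/k + 8/k\<^sup>2 + \<dots>\<close>. The orders \<open>1\<close> and \<open>1/k\<close> agree, so the
  quartic factor decides: it lowers the ratio by \<open>4n/k\<^sup>3\<close>, and at this order the two sides balance when
  \<open>n = k\<close>, that is \<open>k = N/2\<close>.

  For \<open>n < k\<close> the comparison can be made without error terms. Integrating \<open>y \<psi>(y)\<close> by parts against
  the Gaussian and using \<open>sinh\<^sup>2 y \<ge> y\<^sup>2 + y\<^sup>4/3\<close> and \<open>y (y - tanh y) \<le> y\<^sup>4/3\<close> yields
  \<open>w(2) > (1 + 2/k) w(0)\<close> (\<open>cw_average_increase_at_centre\<close>). The symmetric sequence \<open>p\<close> then still
  increases just to the right of its centre, which rules out unimodality.

  For \<open>n > k\<close>, log-concavity passes from \<open>k + 1\<close> to \<open>k\<close>, because ignoring one spin is a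
  hypergeometric thinning (\<open>log_concave_seq_thinning\<close>). It therefore suffices to treat one window
  length, close to \<open>(1/2 - \<epsilon>) N\<close>, where \<open>n/k\<close> is bounded and bounded away from \<open>1\<close>. If
  \<open>s\<^sup>2 \<ge> 3k\<close>, the bound \<open>w(s + 2) w(s - 2) \<le> exp (4/k) w(s)\<^sup>2\<close> is enough
  (\<open>cw_average_ratio_le_exp\<close>). If \<open>s\<^sup>2 \<le> 3k\<close>, recentre the integral at \<open>s/k\<close>; the
  arithmetic-geometric mean inequality and one integration by parts reduce the claim to a comparison
  of Gaussian moments, with main terms \<open>1/k\<close> and \<open>n/k\<^sup>2\<close> (\<open>sinh_moment_le\<close>).
\<close>

section \<open>Finite log-concave and unimodal sequences\<close>

text \<open>
  If \<open>q\<close> is the law of a count among \<open>k + 1\<close> items, \<open>r\<close> is the law of the count after a uniformly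
  random item is discarded. The squared term minus the product is a combination, with nonnegative
  coefficients, of the three log-concavity defects of \<open>q\<close> that involve four consecutive entries,
  plus a perfect square.
\<close>
lemma log_concave_seq_thinning:
  assumes q: "log_concave_seq (Suc k) q"
    and r: "\<And>j. j \<le> k \<Longrightarrow>
      real (Suc k) * r j = (real (Suc k) - real j) * q j + (real j + 1) * q (Suc j)"
  shows "log_concave_seq k r"
proof -
  have pos: "0 < q j" if "j \<le> Suc k" for j
    using q that by (simp add: log_concave_seq_def)
  have lc: "q j * q (Suc (Suc j)) \<le> (q (Suc j))\<^sup>2" if "Suc j < Suc k" for j
    using q that unfolding log_concave_seq_def by (auto dest: bspec[of _ _ "Suc j"])
  have r_pos: "0 < r j" if "j \<le> k" for j
  proof -
    have "0 < (real (Suc k) - real j) * q j + (real j + 1) * q (Suc j)"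
      by (rule add_pos_pos; rule mult_pos_pos) (use that pos in auto)
    then show ?thesis using r[OF that] zero_less_mult_pos by (metis of_nat_0_less_iff zero_less_Suc)
  qed
  have "r i * r (Suc (Suc i)) \<le> (r (Suc i))\<^sup>2" if i: "Suc i < k" for i
  proof -
    define \<alpha> \<beta> \<gamma> \<eta> where "\<alpha> = q i" "\<beta> = q (Suc i)" "\<gamma> = q (Suc (Suc i))" "\<eta> = q (Suc (Suc (Suc i)))"
    note defs = this
    have p: "0 < \<alpha>" "0 < \<beta>" "0 < \<gamma>" "0 < \<eta>" using i by (auto simp: defs pos)
    have 1: "\<alpha> * \<gamma> \<le> \<beta>\<^sup>2" and 2: "\<beta> * \<eta> \<le> \<gamma>\<^sup>2" using lc i by (auto simp: defs)
    have "(\<alpha> * \<gamma>) * (\<beta> * \<eta>) \<le> \<beta>\<^sup>2 * \<gamma>\<^sup>2" by (rule mult_mono[OF 1 2]) (use p in auto)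
    then have "(\<alpha> * \<eta>) * (\<beta> * \<gamma>) \<le> (\<beta> * \<gamma>) * (\<beta> * \<gamma>)"
      by (simp add: power2_eq_square mult_ac)
    then have 3: "\<alpha> * \<eta> \<le> \<beta> * \<gamma>" using p by (simp only: mult_le_cancel_right) auto
    \<comment> \<open>The identity below is cleanest in the weights \<open>a\<close> and \<open>j + 1\<close> of \<open>q (Suc i)\<close> and \<open>q (Suc (Suc i))\<close> in \<open>r (Suc i)\<close>.\<close>
    define a j where "a = real (Suc k) - real (Suc i)" and "j = real (Suc i)"
    have aj: "1 \<le> a" "1 \<le> j" using i by (auto simp: a_def j_def)
    define m where "m = real (Suc k)"
    have m: "0 < m" by (simp add: m_def)
    have r0: "m * r i = (a + 1) * \<alpha> + j * \<beta>" and r1: "m * r (Suc i) = a * \<beta> + (j + 1) * \<gamma>"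
      and r2: "m * r (Suc (Suc i)) = (a - 1) * \<gamma> + (j + 2) * \<eta>"
      unfolding m_def defs a_def j_def
      using i r[of i] r[of "Suc i"] r[of "Suc (Suc i)"] by (simp_all add: algebra_simps)
    have "(m * r (Suc i))\<^sup>2 - (m * r i) * (m * r (Suc (Suc i)))
       = (a\<^sup>2 - 1) * (\<beta>\<^sup>2 - \<alpha> * \<gamma>) + j * (j + 2) * (\<gamma>\<^sup>2 - \<beta> * \<eta>)
         + (a + 1) * (j + 2) * (\<beta> * \<gamma> - \<alpha> * \<eta>) + (\<beta> - \<gamma>)\<^sup>2"
      unfolding r0 r1 r2 by (simp add: power2_eq_square algebra_simps)
    also have "\<dots> \<ge> 0"
      using aj 1 2 3 by (intro add_nonneg_nonneg mult_nonneg_nonneg) auto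
    finally have "m\<^sup>2 * (r i * r (Suc (Suc i))) \<le> m\<^sup>2 * (r (Suc i))\<^sup>2"
      by (simp add: power2_eq_square algebra_simps)
    then show ?thesis using m by (simp add: mult_le_cancel_left)
  qed
  then have "r (j - 1) * r (j + 1) \<le> (r j)\<^sup>2" if "j \<in> {1..<k}" for j
    using that by (cases j) auto
  then show ?thesis using r_pos by (simp add: log_concave_seq_def)
qed

text \<open>
  Log-concavity propagates descents: once \<open>p\<close> fails to increase it never increases again. So the
  first descent marks the mode.
\<close>
lemma log_concave_seq_imp_unimodal_seq:
  assumes "log_concave_seq k p"
  shows "unimodal_seq k p"
proof -
  have pos: "0 < p j" if "j \<le> k" for j
    using assms that by (simp add: log_concave_seq_def)
  define m where "m = (LEAST j. j = k \<or> p (Suc j) \<le> p j)"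
  have m: "m = k \<or> p (Suc m) \<le> p m"
    unfolding m_def by (rule LeastI[of _ k]) simp
  have "m \<le> k" unfolding m_def by (rule Least_le) simp
  have up: "p j \<le> p (Suc j)" if "j < m" for j
    using not_less_Least[of j "\<lambda>j. j = k \<or> p (Suc j) \<le> p j"] that by (auto simp: m_def)
  have down: "p (Suc j) \<le> p j" if "m \<le> j" "j < k" for j
    using that
  proof (induction j rule: dec_induct)
    case base
    then show ?case using m by auto
  next
    case (step j)
    have "p j * p (Suc (Suc j)) \<le> (p (Suc j))\<^sup>2"
      using assms step.prems unfolding log_concave_seq_def by (auto dest: bspec[of _ _ "Suc j"])
    also have "\<dots> \<le> p j * p (Suc j)"
      unfolding power2_eq_square using step pos[of "Suc j"] by (intro mult_right_mono) auto
    finally show ?case using pos[of j] step.prems by (simp add: mult_le_cancel_left)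
  qed
  have "mono_on {0..m} p"
  proof (rule mono_onI)
    fix i j assume ij: "i \<in> {0..m}" "j \<in> {0..m}" "i \<le> j"
    from \<open>i \<le> j\<close> have "j \<le> m \<longrightarrow> p i \<le> p j"
    proof (induction rule: dec_induct)
      case (step l)
      then show ?case using up[of l] by auto
    qed simp
    then show "p i \<le> p j" using ij by simp
  qed
  moreover have "antimono_on {m..k} p"
  proof (rule monotone_onI)
    fix i j assume ij: "i \<in> {m..k}" "j \<in> {m..k}" "i \<le> j"
    from \<open>i \<le> j\<close> have "j \<le> k \<longrightarrow> p j \<le> p i"
    proof (induction rule: dec_induct)
      case (step l)
      then show ?case using down[of l] ij by auto
    qed simp
    then show "p i \<ge> p j" using ij by simp
  qed
  ultimately show ?thesis using \<open>m \<le> k\<close> by (auto simp: unimodal_seq_def)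
qed

text \<open>
  By symmetry an increase to the right of the centre is mirrored by a decrease to the left of it, and
  a unimodal sequence cannot decrease before it increases.
\<close>
lemma not_unimodal_if_increase_past_centre:
  assumes sym: "\<And>j. j \<le> k \<Longrightarrow> p (k - j) = p j"
    and i: "k \<le> 2 * i" "i < k" "p i < p (Suc i)"
  shows "\<not> unimodal_seq k p"
proof
  assume "unimodal_seq k p"
  then obtain m where m: "m \<le> k" "mono_on {0..m} p" "antimono_on {m..k} p"
    by (auto simp: unimodal_seq_def)
  show False
  proof (cases "m \<le> i")
    case True
    then show False using monotone_onD[OF m(3), of i "Suc i"] i by auto
  next
    case False
    then have "p (k - Suc i) \<le> p (k - i)"
      using i by (intro mono_onD[OF m(2)]) auto
    then show False using sym[of i] sym[of "Suc i"] i by simp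
  qed
qed

section \<open>The plus count and random-walk averages\<close>

text \<open>
  The expectation of \<open>f (s + S\<^sub>n)\<close> for a simple random walk \<open>S\<close> started at \<open>0\<close>. Each spin that is summed
  out contributes one step.
\<close>
primrec walk_average :: "(real \<Rightarrow> real) \<Rightarrow> nat \<Rightarrow> real \<Rightarrow> real" where
  "walk_average f 0 s = f s"
| "walk_average f (Suc n) s = (walk_average f n (s + 1) + walk_average f n (s - 1)) / 2"

lemma walk_average_first_step:
  "walk_average f (Suc n) s = walk_average (\<lambda>x. (f (x + 1) + f (x - 1)) / 2) n s"
proof (induction n arbitrary: s)
  case (Suc n)
  show ?case unfolding walk_average.simps(2)[of f "Suc n"] Suc.IH by simp
qed simp

lemma finite_spin_configs: "finite (spin_configs N)"
  by (simp add: spin_configs_def finite_PiE)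

lemma spin_sum_eq:
  assumes "\<sigma> \<in> spin_configs k"
  shows "(\<Sum>i=1..k. \<sigma> i) = 2 * real (plus_count k \<sigma>) - real k"
proof -
  have v: "\<sigma> i = 2 * (if \<sigma> i = 1 then 1 else 0) - 1" if "i \<in> {1..k}" for i
  proof -
    have "\<sigma> i \<in> {-1, 1}" using assms that by (auto simp: spin_configs_def PiE_iff)
    then show ?thesis by auto
  qed
  have "(\<Sum>i=1..k. \<sigma> i) = (\<Sum>i=1..k. 2 * (if \<sigma> i = 1 then 1 else 0) - 1)"
    by (intro sum.cong refl v)
  also have "\<dots> = 2 * (\<Sum>i=1..k. if \<sigma> i = 1 then 1 else 0) - real k"
    by (simp add: sum_subtractf sum_distrib_left)
  also have "(\<Sum>i=1..k. if \<sigma> i = 1 then 1 else 0 :: real) = real (plus_count k \<sigma>)"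
    by (simp add: plus_count_def sum.If_cases Int_def)
  finally show ?thesis .
qed

lemma card_plus_count: "card {\<sigma> \<in> spin_configs k. plus_count k \<sigma> = j} = k choose j"
proof -
  have "bij_betw (\<lambda>\<sigma>. {i \<in> {1..k}. \<sigma> i = 1}) {\<sigma> \<in> spin_configs k. plus_count k \<sigma> = j}
          {A. A \<subseteq> {1..k} \<and> card A = j}"
  proof (rule bij_betw_byWitness[where f' = "\<lambda>A. restrict (\<lambda>i. if i \<in> A then 1 else -1) {1..k}"])
    show "\<forall>\<sigma>\<in>{\<sigma> \<in> spin_configs k. plus_count k \<sigma> = j}.
        restrict (\<lambda>i. if i \<in> {i \<in> {1..k}. \<sigma> i = 1} then 1 else -1) {1..k} = \<sigma>"
    proof (intro ballI ext)
      fix \<sigma> i assume "\<sigma> \<in> {\<sigma> \<in> spin_configs k. plus_count k \<sigma> = j}"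
      then have "\<sigma> \<in> {1..k} \<rightarrow>\<^sub>E {-1, 1}" by (simp add: spin_configs_def)
      then show "restrict (\<lambda>i. if i \<in> {i \<in> {1..k}. \<sigma> i = 1} then 1 else -1) {1..k} i = \<sigma> i"
        by (cases "i \<in> {1..k}") (auto dest: PiE_mem PiE_arb)
    qed
    have *: "{i \<in> {1..k}. restrict (\<lambda>i. if i \<in> A then 1 else -1 :: real) {1..k} i = 1} = A"
      if "A \<subseteq> {1..k}" for A
      using that by (auto split: if_splits)
    then show "\<forall>A\<in>{A. A \<subseteq> {1..k} \<and> card A = j}.
        {i \<in> {1..k}. restrict (\<lambda>i. if i \<in> A then 1 else -1 :: real) {1..k} i = 1} = A"
      by blast
    show "(\<lambda>\<sigma>. {i \<in> {1..k}. \<sigma> i = 1}) ` {\<sigma> \<in> spin_configs k. plus_count k \<sigma> = j}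
        \<subseteq> {A. A \<subseteq> {1..k} \<and> card A = j}"
      by (auto simp: plus_count_def)
    show "(\<lambda>A. restrict (\<lambda>i. if i \<in> A then 1 else -1) {1..k}) ` {A. A \<subseteq> {1..k} \<and> card A = j}
        \<subseteq> {\<sigma> \<in> spin_configs k. plus_count k \<sigma> = j}"
      using * by (auto simp: plus_count_def spin_configs_def split: if_splits)
  qed
  then have "card {\<sigma> \<in> spin_configs k. plus_count k \<sigma> = j} = card {A. A \<subseteq> {1..k} \<and> card A = j}"
    by (rule bij_betw_same_card)
  then show ?thesis by (simp add: n_subsets)
qed

lemma spin_configs_Suc_sum:
  "(\<Sum>\<sigma>\<in>spin_configs (Suc M). g \<sigma>)
   = (\<Sum>\<sigma>\<in>spin_configs M. g (\<sigma>(Suc M := 1)) + g (\<sigma>(Suc M := -1)))"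
proof -
  have *: "{1..Suc M} = insert (Suc M) {1..M}" by auto
  have "spin_configs (Suc M) = (\<lambda>(v, \<sigma>). \<sigma>(Suc M := v)) ` ({-1, 1} \<times> spin_configs M)"
    unfolding spin_configs_def *
    by (rule PiE_insert_eq)
  moreover have "inj_on (\<lambda>(v, \<sigma>). \<sigma>(Suc M := v)) ({-1, 1} \<times> spin_configs M)"
    unfolding spin_configs_def by (rule inj_combinator) auto
  ultimately have "(\<Sum>\<sigma>\<in>spin_configs (Suc M). g \<sigma>)
      = (\<Sum>(v, \<sigma>)\<in>{-1, 1} \<times> spin_configs M. g (\<sigma>(Suc M := v)))"
    by (simp add: sum.reindex case_prod_unfold)
  also have "\<dots> = (\<Sum>v\<in>{-1, 1}. \<Sum>\<sigma>\<in>spin_configs M. g (\<sigma>(Suc M := v)))"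
    by (rule sum.cartesian_product[symmetric])
  also have "\<dots> = (\<Sum>\<sigma>\<in>spin_configs M. g (\<sigma>(Suc M := 1)) + g (\<sigma>(Suc M := -1)))"
    by (simp add: sum.distrib add.commute)
  finally show ?thesis .
qed

text \<open>
  Induction on the number of spins outside the window: summing over the two values of the last spin
  replaces \<open>f\<close> by twice its average over one step of the walk.
\<close>
lemma sum_spin_configs_plus_count:
  "(\<Sum>\<sigma>\<in>spin_configs (k + n). if plus_count k \<sigma> = j then f (\<Sum>i=1..k + n. \<sigma> i) else 0)
   = 2 ^ n * real (k choose j) * walk_average f n (2 * real j - real k)"
proof (induction n arbitrary: f)
  case 0
  have "(\<Sum>\<sigma>\<in>spin_configs k. if plus_count k \<sigma> = j then f (\<Sum>i=1..k. \<sigma> i) else 0)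
      = (\<Sum>\<sigma>\<in>{\<sigma> \<in> spin_configs k. plus_count k \<sigma> = j}. f (2 * real j - real k))"
    unfolding sum.inter_filter[OF finite_spin_configs]
    by (rule sum.cong) (auto simp: spin_sum_eq simp del: One_nat_def)
  then show ?case unfolding add_0_right by (simp add: card_plus_count)
next
  case (Suc n)
  let ?g = "\<lambda>x. (f (x + 1) + f (x - 1)) / 2"
  have pc: "plus_count k (\<sigma>(Suc (k + n) := v)) = plus_count k \<sigma>" for \<sigma> v
  proof -
    have "{i \<in> {1..k}. (\<sigma>(Suc (k + n) := v)) i = 1} = {i \<in> {1..k}. \<sigma> i = 1}" by auto
    then show ?thesis by (simp only: plus_count_def)
  qed
  have sm: "(\<Sum>i=1..Suc (k + n). (\<sigma>(Suc (k + n) := v)) i) = (\<Sum>i=1..k + n. \<sigma> i) + v" for \<sigma> :: "nat \<Rightarrow> real" and v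
  proof -
    have "(\<Sum>i=1..k + n. (\<sigma>(Suc (k + n) := v)) i) = (\<Sum>i=1..k + n. \<sigma> i)"
      by (rule sum.cong) auto
    then show ?thesis by simp
  qed
  have "(\<Sum>\<sigma>\<in>spin_configs (k + Suc n). if plus_count k \<sigma> = j then f (\<Sum>i=1..k + Suc n. \<sigma> i) else 0)
      = (\<Sum>\<sigma>\<in>spin_configs (k + n). 2 * (if plus_count k \<sigma> = j then ?g (\<Sum>i=1..k + n. \<sigma> i) else 0))"
    unfolding add_Suc_right spin_configs_Suc_sum pc sm by (rule sum.cong) auto
  also have "\<dots> = 2 * (2 ^ n * real (k choose j) * walk_average ?g n (2 * real j - real k))"
    using Suc.IH[of ?g] by (simp only: sum_distrib_left[symmetric])
  finally show ?case unfolding walk_average_first_step by simp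
qed

abbreviation cw_average :: "nat \<Rightarrow> nat \<Rightarrow> real \<Rightarrow> real" where
  "cw_average N \<equiv> walk_average (\<lambda>s. exp (s\<^sup>2 / (2 * real N)))"

lemma cw_partition_pos: "0 < cw_partition N"
proof -
  have "(\<lambda>i\<in>{1..N}. 1) \<in> spin_configs N" by (simp add: spin_configs_def)
  then show ?thesis
    unfolding cw_partition_def using finite_spin_configs
    by (intro sum_pos) (auto simp: cw_weight_def)
qed

lemma plus_prob_eq:
  assumes "k \<le> N"
  shows "plus_prob N k j = 2 ^ (N - k) / cw_partition N *
           (real (k choose j) * cw_average N (N - k) (2 * real j - real k))"
proof -
  have "plus_prob N k j = (\<Sum>\<sigma>\<in>{\<sigma> \<in> spin_configs N. plus_count k \<sigma> = j}. cw_weight N \<sigma> / cw_partition N)"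
    unfolding plus_prob_def curie_weiss_def space_point_measure
    using cw_partition_pos[of N] finite_spin_configs[of N]
    by (subst measure_def, subst emeasure_point_measure_finite)
      (auto simp: cw_weight_def sum_nonneg intro!: sum_nonneg)
  also have "\<dots> = (\<Sum>\<sigma>\<in>spin_configs (k + (N - k)). if plus_count k \<sigma> = j
      then (\<lambda>s. exp (s\<^sup>2 / (2 * real N))) (\<Sum>i=1..k + (N - k). \<sigma> i) else 0) / cw_partition N"
    using assms finite_spin_configs
    by (simp add: cw_weight_def sum_divide_distrib sum.inter_filter[symmetric])
  finally show ?thesis
    using sum_spin_configs_plus_count
      [where f = "\<lambda>s. exp (s\<^sup>2 / (2 * real N))" and k = k and n = "N - k" and j = j] by simp
qed

lemma cw_average_pos: "0 < cw_average N n s"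
  by (induction n arbitrary: s) (auto intro!: add_pos_pos divide_pos_pos)

lemma cw_average_even: "cw_average N n (- s) = cw_average N n s"
proof (induction n arbitrary: s)
  case (Suc n)
  have "- s + 1 = - (s - 1)" "- s - 1 = - (s + 1)" by simp_all
  then show ?case by (simp only: walk_average.simps(2) Suc) (simp add: add.commute)
qed simp

lemma plus_prob_symmetric:
  assumes "k \<le> N" "j \<le> k"
  shows "plus_prob N k (k - j) = plus_prob N k j"
proof -
  have "2 * real (k - j) - real k = - (2 * real j - real k)"
    using assms by (simp add: of_nat_diff)
  then show ?thesis
    using assms by (simp only: plus_prob_eq cw_average_even binomial_symmetric[OF assms(2), symmetric])
qed

text \<open>
  Exchangeability of the spins: the window of length \<open>k\<close> arises from the one of length \<open>k + 1\<close> by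
  discarding a uniformly random spin. This supplies the hypothesis of
  \<open>log_concave_seq_thinning\<close>.
\<close>
lemma plus_prob_thinning:
  assumes "k < N" "j \<le> k"
  shows "real (Suc k) * plus_prob N k j
    = (real (Suc k) - real j) * plus_prob N (Suc k) j + (real j + 1) * plus_prob N (Suc k) (Suc j)"
proof -
  obtain n where n: "N - k = Suc n" "N - Suc k = n"
    using assms by (metis Suc_diff_Suc)
  define C where "C = 2 ^ n / cw_partition N"
  define U V where "U = cw_average N n (2 * real j - real k + 1)"
    and "V = cw_average N n (2 * real j - real k - 1)"
  have p: "plus_prob N k j = C * (real (k choose j) * (U + V))"
    using assms by (simp add: plus_prob_eq n C_def U_def V_def)
  have q: "plus_prob N (Suc k) j = C * (real (Suc k choose j) * V)"
    and q': "plus_prob N (Suc k) (Suc j) = C * (real (Suc k choose Suc j) * U)"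
    using assms by (simp_all add: plus_prob_eq n C_def U_def V_def algebra_simps del: binomial_Suc_Suc)
  have "(Suc k - j) * (Suc k choose j) = Suc k * (k choose j)"
    using binomial_absorb_comp[of "Suc k" j] by simp
  then have b: "(real (Suc k) - real j) * real (Suc k choose j) = real (Suc k) * real (k choose j)"
    using assms by (metis of_nat_diff of_nat_mult le_SucI)
  have b': "(real j + 1) * real (Suc k choose Suc j) = real (Suc k) * real (k choose j)"
    using Suc_times_binomial_eq[of k j] by (metis of_nat_mult mult.commute of_nat_Suc add.commute)
  have "(real (Suc k) - real j) * plus_prob N (Suc k) j + (real j + 1) * plus_prob N (Suc k) (Suc j)
     = C * (((real (Suc k) - real j) * real (Suc k choose j)) * V
         + ((real j + 1) * real (Suc k choose Suc j)) * U)"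
    unfolding q q' by (simp only: algebra_simps)
  also have "\<dots> = real (Suc k) * plus_prob N k j"
    unfolding b b' p by (simp add: algebra_simps)
  finally show ?thesis by simp
qed

lemma log_concave_plus_prob_downward:
  assumes "k \<le> k'" "k' \<le> N" "log_concave_seq k' (plus_prob N k')"
  shows "log_concave_seq k (plus_prob N k)"
  using assms
proof (induction rule: inc_induct)
  case (step m)
  then show ?case
    by (intro log_concave_seq_thinning[of m "plus_prob N (Suc m)"] plus_prob_thinning) auto
qed

section \<open>Hyperbolic inequalities\<close>

lemma tanh_le_self: "0 \<le> y \<Longrightarrow> tanh y \<le> (y::real)"
proof -
  assume "0 \<le> y"
  have "0 - tanh 0 \<le> y - tanh y"
    by (rule DERIV_nonneg_imp_nondecreasing[OF \<open>0 \<le> y\<close>])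
      (auto intro!: derivative_eq_intros exI)
  then show ?thesis by simp
qed

lemma tanh_square_le: "(tanh y)\<^sup>2 \<le> (y::real)\<^sup>2"
proof -
  have "\<bar>tanh y\<bar> \<le> \<bar>y\<bar>"
    using tanh_le_self[of "\<bar>y\<bar>"] by (cases "y \<ge> 0") auto
  then show ?thesis by (rule abs_le_square_iff[THEN iffD1])
qed

lemma tanh_defect_le: "0 \<le> y \<Longrightarrow> y - tanh y \<le> (y::real) ^ 3 / 3"
proof -
  assume "0 \<le> y"
  have "tanh 0 - 0 + 0 ^ 3 / 3 \<le> tanh y - y + y ^ 3 / 3"
  proof (rule DERIV_nonneg_imp_nondecreasing[OF \<open>0 \<le> y\<close>])
    fix x :: real
    have "((\<lambda>y. tanh y - y + y ^ 3 / 3) has_real_derivative x\<^sup>2 - (tanh x)\<^sup>2) (at x)"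
      by (auto intro!: derivative_eq_intros)
    then show "\<exists>d. ((\<lambda>y. tanh y - y + y ^ 3 / 3) has_real_derivative d) (at x) \<and> 0 \<le> d"
      using tanh_square_le[of x] by auto
  qed
  then show ?thesis by simp
qed

lemma tanh_defect_mult_le: "y * (y - tanh y) \<le> (y::real) ^ 4 / 3"
proof -
  have *: "y * (y - tanh y) \<le> y ^ 4 / 3" if "0 \<le> y" for y :: real
    using mult_left_mono[OF tanh_defect_le[OF that] that] by (simp add: eval_nat_numeral)
  show ?thesis using *[of y] *[of "-y"] by (cases "y \<ge> 0") (auto simp: algebra_simps)
qed

lemma tanh_defect_square_le: "(y - tanh y)\<^sup>2 \<le> (y::real) ^ 6 / 9"
proof -
  have *: "(y - tanh y)\<^sup>2 \<le> y ^ 6 / 9" if "0 \<le> y" for y :: real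
  proof -
    have "(y - tanh y)\<^sup>2 \<le> (y ^ 3 / 3)\<^sup>2"
      using tanh_defect_le[OF that] tanh_le_self[OF that] by (intro power_mono) auto
    then show ?thesis by (simp add: power_divide flip: power_mult)
  qed
  have "(y - tanh y)\<^sup>2 = (- y - tanh (- y))\<^sup>2" by (simp add: power2_commute)
  then show ?thesis using *[of y] *[of "-y"] by (cases "y \<ge> 0") auto
qed

lemma tanh_square_ge: "(y::real)\<^sup>2 - 2 / 3 * y ^ 4 \<le> (tanh y)\<^sup>2"
proof -
  have "y\<^sup>2 - (tanh y)\<^sup>2 = 2 * (y * (y - tanh y)) - (y - tanh y)\<^sup>2"
    by (simp add: power2_eq_square algebra_simps)
  also have "\<dots> \<le> 2 * (y ^ 4 / 3) - 0"
    by (intro diff_mono mult_left_mono tanh_defect_mult_le) auto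
  finally show ?thesis by simp
qed

lemma cosh_ge_quadratic: "1 + y\<^sup>2 / 2 \<le> cosh (y::real)"
  and sinh_ge_cubic: "0 \<le> y \<Longrightarrow> y + y ^ 3 / 6 \<le> sinh y"
proof -
  have s: "x \<le> sinh x" if "0 \<le> x" for x :: real
  proof -
    have "sinh 0 - 0 \<le> sinh x - x"
    proof (rule DERIV_nonneg_imp_nondecreasing[OF that])
      fix u :: real
      have "((\<lambda>u. sinh u - u) has_real_derivative cosh u - 1) (at u)"
        by (auto intro!: derivative_eq_intros)
      then show "\<exists>d. ((\<lambda>u. sinh u - u) has_real_derivative d) (at u) \<and> 0 \<le> d"
        using cosh_real_ge_1[of u] by auto
    qed
    then show ?thesis by simp
  qed
  have c0: "1 + x\<^sup>2 / 2 \<le> cosh x" if "0 \<le> x" for x :: real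
  proof -
    have "cosh 0 - 1 - 0\<^sup>2 / 2 \<le> cosh x - 1 - x\<^sup>2 / 2"
    proof (rule DERIV_nonneg_imp_nondecreasing[OF that])
      fix u :: real assume "0 \<le> u"
      have "((\<lambda>u. cosh u - 1 - u\<^sup>2 / 2) has_real_derivative sinh u - u) (at u)"
        by (auto intro!: derivative_eq_intros)
      then show "\<exists>d. ((\<lambda>u. cosh u - 1 - u\<^sup>2 / 2) has_real_derivative d) (at u) \<and> 0 \<le> d"
        using s[OF \<open>0 \<le> u\<close>] by auto
    qed
    then show ?thesis by simp
  qed
  show c: "1 + x\<^sup>2 / 2 \<le> cosh x" for x :: real
    using c0[of x] c0[of "-x"] by (cases "0 \<le> x") auto
  assume y: "0 \<le> y"
  have "sinh 0 - 0 - 0 ^ 3 / 6 \<le> sinh y - y - y ^ 3 / 6"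
  proof (rule DERIV_nonneg_imp_nondecreasing[OF y])
    fix u :: real
    have "((\<lambda>u. sinh u - u - u ^ 3 / 6) has_real_derivative cosh u - 1 - u\<^sup>2 / 2) (at u)"
      by (auto intro!: derivative_eq_intros)
    then show "\<exists>d. ((\<lambda>u. sinh u - u - u ^ 3 / 6) has_real_derivative d) (at u) \<and> 0 \<le> d"
      using c[of u] by auto
  qed
  then show "y + y ^ 3 / 6 \<le> sinh y" by simp
qed

lemma sinh_square_ge: "(y::real)\<^sup>2 + y ^ 4 / 3 \<le> (sinh y)\<^sup>2"
proof -
  have *: "y\<^sup>2 + y ^ 4 / 3 \<le> (sinh y)\<^sup>2" if "0 \<le> y" for y :: real
  proof -
    have "y\<^sup>2 + y ^ 4 / 3 \<le> y\<^sup>2 + y ^ 4 / 3 + y ^ 6 / 36" using that by simp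
    also have "\<dots> = (y + y ^ 3 / 6)\<^sup>2"
      by (simp add: eval_nat_numeral field_simps)
    also have "\<dots> \<le> (sinh y)\<^sup>2"
      using that by (intro power_mono sinh_ge_cubic) auto
    finally show ?thesis .
  qed
  show ?thesis using *[of y] *[of "-y"] by (cases "y \<ge> 0") auto
qed

lemma cosh_times_gauss_deriv:
  "((\<lambda>y. cosh y * exp (- (y\<^sup>2 / 2))) has_real_derivative
     (tanh y - y) * (cosh y * exp (- (y\<^sup>2 / 2)))) (at y)"
  by (auto intro!: derivative_eq_intros simp: tanh_def field_simps)

lemma cosh_le_exp_half_square: "cosh y \<le> exp ((y::real)\<^sup>2 / 2)"
proof -
  have *: "cosh y * exp (- (y\<^sup>2 / 2)) \<le> 1" if "0 \<le> y" for y :: real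
  proof -
    have "cosh y * exp (- (y\<^sup>2 / 2)) \<le> cosh 0 * exp (- (0\<^sup>2 / 2))"
    proof (rule DERIV_nonpos_imp_nonincreasing[OF that])
      fix x :: real assume "0 \<le> x"
      then have "(tanh x - x) * (cosh x * exp (- (x\<^sup>2 / 2))) \<le> 0"
        using tanh_le_self[of x] by (intro mult_nonpos_nonneg) auto
      then show "\<exists>d. ((\<lambda>y. cosh y * exp (- (y\<^sup>2 / 2))) has_real_derivative d) (at x) \<and> d \<le> 0"
        using cosh_times_gauss_deriv by blast
    qed
    then show ?thesis by simp
  qed
  have "cosh y * exp (- (y\<^sup>2 / 2)) \<le> 1"
    using *[of y] *[of "-y"] by (cases "y \<ge> 0") auto
  then show ?thesis by (simp add: exp_minus field_simps)
qed

lemma exp_le_cubic: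
  assumes "0 \<le> x" "x \<le> (1::real)"
  shows "exp x \<le> 1 + x + x\<^sup>2 / 2 + x ^ 3"
proof -
  have "1 + 0 + 0\<^sup>2 / 2 + 0 ^ 3 - exp 0 \<le> 1 + x + x\<^sup>2 / 2 + x ^ 3 - exp x"
  proof (rule DERIV_nonneg_imp_nondecreasing[OF assms(1)])
    fix u :: real assume u: "0 \<le> u" "u \<le> x"
    have "((\<lambda>x. 1 + x + x\<^sup>2 / 2 + x ^ 3 - exp x) has_real_derivative 1 + u + 3 * u\<^sup>2 - exp u) (at u)"
      by (auto intro!: derivative_eq_intros)
    moreover have "exp u \<le> 1 + u + 3 * u\<^sup>2"
      using exp_bound[of u] u assms by (smt (verit) zero_le_power2)
    ultimately show "\<exists>d. ((\<lambda>x. 1 + x + x\<^sup>2 / 2 + x ^ 3 - exp x) has_real_derivative d) (at u) \<and> 0 \<le> d"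
      by auto
  qed
  then show ?thesis by simp
qed

lemma fourth_power_add_le: "((z::real) + a) ^ 4 \<le> 8 * (z ^ 4 + a ^ 4)"
  and sixth_power_add_le: "((z::real) + a) ^ 6 \<le> 32 * (z ^ 6 + a ^ 6)"
proof -
  have sq: "(x + y)\<^sup>2 \<le> 2 * (x\<^sup>2 + y\<^sup>2)" for x y :: real
    using sum_squares_bound[of x y] by (simp add: power2_eq_square algebra_simps)
  have cub: "(x + y) ^ 3 \<le> 4 * (x ^ 3 + y ^ 3)" if "0 \<le> x" "0 \<le> y" for x y :: real
  proof -
    have "4 * (x ^ 3 + y ^ 3) - (x + y) ^ 3 = 3 * (x + y) * (x - y)\<^sup>2"
      by (simp add: eval_nat_numeral algebra_simps)
    moreover have "0 \<le> 3 * (x + y) * (x - y)\<^sup>2" using that by simp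
    ultimately show ?thesis by linarith
  qed
  have "((z + a)\<^sup>2)\<^sup>2 \<le> (2 * (z\<^sup>2 + a\<^sup>2))\<^sup>2"
    by (intro power_mono sq) auto
  also have "\<dots> \<le> 4 * (2 * ((z\<^sup>2)\<^sup>2 + (a\<^sup>2)\<^sup>2))"
    unfolding power_mult_distrib using sq[of "z\<^sup>2" "a\<^sup>2"] by simp
  finally show "(z + a) ^ 4 \<le> 8 * (z ^ 4 + a ^ 4)"
    by (simp flip: power_mult)
  have "((z + a)\<^sup>2) ^ 3 \<le> (2 * (z\<^sup>2 + a\<^sup>2)) ^ 3"
    by (intro power_mono sq) auto
  also have "\<dots> \<le> 8 * (4 * ((z\<^sup>2) ^ 3 + (a\<^sup>2) ^ 3))"
    unfolding power_mult_distrib using cub[of "z\<^sup>2" "a\<^sup>2"] by simp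
  finally show "(z + a) ^ 6 \<le> 32 * (z ^ 6 + a ^ 6)"
    by (simp flip: power_mult)
qed

section \<open>A bound on the second ratio that holds everywhere\<close>

text \<open>
  The factor \<open>exp (4 / (N - n))\<close> is the value of the ratio for the Gaussian \<open>exp (s\<^sup>2 / 2(N - n))\<close>, which
  is \<open>w\<close> itself when \<open>n = 0\<close>. One step of the walk replaces a bound \<open>B\<close> for the ratio by
  \<open>((1 + B) / 2)\<^sup>2\<close>, the extreme case being \<open>w (s + 1) = w (s - 1)\<close>. With \<open>B = exp (4 / (k + 1))\<close> the
  inequality \<open>cosh x \<le> exp (x\<^sup>2 / 2)\<close> shows that the new bound is at most \<open>exp (4 / k)\<close>.
\<close>
lemma cw_average_ratio_le_exp:
  assumes "n < N"
  shows "cw_average N n (s + 2) * cw_average N n (s - 2)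
         \<le> exp (4 / real (N - n)) * (cw_average N n s)\<^sup>2"
  using assms
proof (induction n arbitrary: s)
  case 0
  then show ?case
    by (simp add: power2_eq_square field_simps flip: exp_add)
next
  case (Suc n)
  define B where "B = exp (4 / real (N - n))"
  let ?w = "cw_average N n"
  define X Y where "X = ?w (s + 1)" and "Y = ?w (s - 1)"
  have XY: "X > 0" "Y > 0" by (simp_all add: X_def Y_def cw_average_pos)
  have "n < N" using Suc by simp
  from Suc.IH[OF this, of "s + 1"] Suc.IH[OF this, of "s - 1"]
  have up: "?w (s + 3) * Y \<le> B * X\<^sup>2" and down: "X * ?w (s - 3) \<le> B * Y\<^sup>2"
    by (simp_all add: X_def Y_def B_def algebra_simps)
  \<comment> \<open>The product of the two outermost values is bounded by multiplying the two induction hypotheses.\<close>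
  have "(?w (s + 3) * Y) * (X * ?w (s - 3)) \<le> (B * X\<^sup>2) * (B * Y\<^sup>2)"
    by (rule mult_mono[OF up down]) (use XY cw_average_pos[of N n "s - 3"] in \<open>auto simp: B_def\<close>)
  then have "(?w (s + 3) * ?w (s - 3)) * (X * Y) \<le> (B\<^sup>2 * (X * Y)) * (X * Y)"
    by (simp add: power2_eq_square mult_ac)
  then have both: "?w (s + 3) * ?w (s - 3) \<le> B\<^sup>2 * (X * Y)"
    using XY by (simp only: mult_le_cancel_right) auto
  have "(?w (s + 3) + X) * (Y + ?w (s - 3)) \<le> B * X\<^sup>2 + B\<^sup>2 * (X * Y) + X * Y + B * Y\<^sup>2"
    using up down both by (simp add: algebra_simps)
  also have "\<dots> = ((1 + B) / 2)\<^sup>2 * (X + Y)\<^sup>2 - ((B - 1) / 2)\<^sup>2 * (X - Y)\<^sup>2"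
    by (simp add: power2_eq_square field_simps)
  also have "\<dots> \<le> ((1 + B) / 2)\<^sup>2 * (X + Y)\<^sup>2" by simp
  also have "\<dots> \<le> exp (4 / real (N - Suc n)) * (X + Y)\<^sup>2"
  proof (rule mult_right_mono)
    define k where "k = real (N - Suc n)"
    have k: "k > 0" and Nn: "real (N - n) = k + 1" using Suc.prems by (auto simp: k_def)
    define x where "x = 2 / (k + 1)"
    have "(1 + B) / 2 = exp x * cosh x"
      by (simp add: B_def Nn x_def cosh_def field_simps flip: exp_add)
    also have "\<dots> \<le> exp x * exp (x\<^sup>2 / 2)"
      by (intro mult_left_mono cosh_le_exp_half_square) auto
    finally have "((1 + B) / 2)\<^sup>2 \<le> (exp x * exp (x\<^sup>2 / 2))\<^sup>2"
      by (intro power_mono) (auto simp: B_def)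
    also have "\<dots> = exp (2 * x + x\<^sup>2)"
      by (simp add: power2_eq_square flip: exp_add)
    also have "2 * x + x\<^sup>2 \<le> 4 / k"
    proof -
      have "2 * x + x\<^sup>2 = 4 * (k + 2) / (k + 1)\<^sup>2"
        using k by (simp add: x_def power2_eq_square divide_simps)
      also have "\<dots> \<le> 4 / k"
        using k by (simp add: divide_simps) (simp add: power2_eq_square algebra_simps)
      finally show ?thesis .
    qed
    finally show "((1 + B) / 2)\<^sup>2 \<le> exp (4 / real (N - Suc n))"
      by (simp add: k_def)
  qed simp
  finally show ?case
    by (simp add: X_def Y_def power2_eq_square algebra_simps)
qed

section \<open>Gaussian integrals of functions of exponential growth\<close>

text \<open>
  At most exponential growth: a class stable under the algebraic operations, whose members become
  integrable and decay at infinity when multiplied by any Gaussian.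
\<close>
definition exp_bounded :: "(real \<Rightarrow> real) \<Rightarrow> bool" where
  "exp_bounded f \<longleftrightarrow>
     f \<in> borel_measurable borel \<and> (\<exists>K b. \<forall>y. \<bar>f y\<bar> \<le> K * exp (b * \<bar>y\<bar>))"

lemma exp_boundedI:
  assumes "f \<in> borel_measurable borel" "\<And>y. \<bar>f y\<bar> \<le> K * exp (b * \<bar>y\<bar>)"
  shows "exp_bounded f"
  using assms unfolding exp_bounded_def by blast

lemma exp_boundedE:
  assumes "exp_bounded f"
  obtains K b where "0 < K" "0 < b" "\<And>y. \<bar>f y\<bar> \<le> K * exp (b * \<bar>y\<bar>)"
proof -
  obtain K b where *: "\<And>y. \<bar>f y\<bar> \<le> K * exp (b * \<bar>y\<bar>)"
    using assms unfolding exp_bounded_def by blast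
  have "0 \<le> K" using *[of 0] by simp
  have "\<bar>f y\<bar> \<le> (K + 1) * exp ((\<bar>b\<bar> + 1) * \<bar>y\<bar>)" for y
    by (rule order_trans[OF *])
      (use \<open>0 \<le> K\<close> in \<open>auto intro!: mult_mono mult_right_mono\<close>)
  then show thesis using \<open>0 \<le> K\<close> by (intro that[of "K + 1" "\<bar>b\<bar> + 1"]) auto
qed

lemma exp_bounded_measurable [measurable_dest]:
  "exp_bounded f \<Longrightarrow> f \<in> borel_measurable borel"
  by (simp add: exp_bounded_def)

lemma exp_bounded_const: "exp_bounded (\<lambda>_. c)"
  by (rule exp_boundedI[where K = "\<bar>c\<bar>" and b = 0]) auto

lemma exp_bounded_id: "exp_bounded (\<lambda>y. y)"
proof (rule exp_boundedI[where K = 1 and b = 1])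
  show "\<bar>y\<bar> \<le> 1 * exp (1 * \<bar>y\<bar>)" for y :: real
    using exp_ge_add_one_self[of "\<bar>y\<bar>"] by (simp del: exp_ge_add_one_self)
qed simp

lemma exp_bounded_exp: "exp_bounded (\<lambda>y. exp (s * y))"
proof (rule exp_boundedI[where K = 1 and b = "\<bar>s\<bar>"])
  show "\<bar>exp (s * y)\<bar> \<le> 1 * exp (\<bar>s\<bar> * \<bar>y\<bar>)" for y :: real
    using abs_ge_self[of "s * y"] by (simp add: abs_mult)
qed measurable

lemma exp_bounded_tanh: "exp_bounded (\<lambda>y. tanh (y + a))"
proof (rule exp_boundedI[where K = 1 and b = 0])
  show "(\<lambda>y. tanh (y + a :: real)) \<in> borel_measurable borel"
    by (intro borel_measurable_continuous_onI continuous_intros) auto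
  show "\<bar>tanh (y + a)\<bar> \<le> 1 * exp (0 * \<bar>y\<bar>)" for y :: real
    using tanh_real_bounds[of "y + a"] by auto
qed

lemma exp_bounded_mult:
  assumes f: "exp_bounded f" and g: "exp_bounded g"
  shows "exp_bounded (\<lambda>y. f y * g y)"
proof -
  obtain K b where 1: "0 < K" "\<And>y. \<bar>f y\<bar> \<le> K * exp (b * \<bar>y\<bar>)"
    using exp_boundedE[OF f] by metis
  obtain L c where 2: "\<And>y. \<bar>g y\<bar> \<le> L * exp (c * \<bar>y\<bar>)"
    using exp_boundedE[OF g] by metis
  show ?thesis
  proof (rule exp_boundedI[where K = "K * L" and b = "b + c"])
    show "(\<lambda>y. f y * g y) \<in> borel_measurable borel"
      using f g by measurable
    fix y :: real
    have "\<bar>f y * g y\<bar> \<le> (K * exp (b * \<bar>y\<bar>)) * (L * exp (c * \<bar>y\<bar>))"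
      unfolding abs_mult by (intro mult_mono 1 2) (use 1 in auto)
    then show "\<bar>f y * g y\<bar> \<le> K * L * exp ((b + c) * \<bar>y\<bar>)"
      by (simp add: exp_add algebra_simps)
  qed
qed

lemma exp_bounded_add:
  assumes f: "exp_bounded f" and g: "exp_bounded g"
  shows "exp_bounded (\<lambda>y. f y + g y)"
proof -
  obtain K b where 1: "0 < K" "0 < b" "\<And>y. \<bar>f y\<bar> \<le> K * exp (b * \<bar>y\<bar>)"
    using exp_boundedE[OF f] by metis
  obtain L c where 2: "0 < L" "0 < c" "\<And>y. \<bar>g y\<bar> \<le> L * exp (c * \<bar>y\<bar>)"
    using exp_boundedE[OF g] by metis
  show ?thesis
  proof (rule exp_boundedI[where K = "K + L" and b = "b + c"])
    show "(\<lambda>y. f y + g y) \<in> borel_measurable borel"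
      using f g by measurable
    fix y :: real
    have "\<bar>f y\<bar> \<le> K * exp ((b + c) * \<bar>y\<bar>)"
      by (rule order_trans[OF 1(3)])
        (use 1 2 in \<open>auto intro!: mult_left_mono mult_right_mono\<close>)
    moreover have "\<bar>g y\<bar> \<le> L * exp ((b + c) * \<bar>y\<bar>)"
      by (rule order_trans[OF 2(3)])
        (use 1 2 in \<open>auto intro!: mult_left_mono mult_right_mono\<close>)
    ultimately show "\<bar>f y + g y\<bar> \<le> (K + L) * exp ((b + c) * \<bar>y\<bar>)"
      unfolding distrib_right[of K L] by linarith
  qed
qed

lemma exp_bounded_diff:
  assumes "exp_bounded f" "exp_bounded g"
  shows "exp_bounded (\<lambda>y. f y - g y)"
proof -
  have "exp_bounded (\<lambda>y. f y + (-1) * g y)"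
    using assms by (intro exp_bounded_add exp_bounded_mult exp_bounded_const)
  then show ?thesis by simp
qed

lemma exp_bounded_power: "exp_bounded f \<Longrightarrow> exp_bounded (\<lambda>y. f y ^ n)"
  by (induction n) (simp_all add: exp_bounded_const exp_bounded_mult)

lemma exp_bounded_sinh: "exp_bounded (\<lambda>y. sinh y)"
proof -
  have "exp_bounded (\<lambda>y. (1/2) * (exp (1 * y) - exp ((-1) * y)))"
    by (intro exp_bounded_mult exp_bounded_add exp_bounded_diff exp_bounded_exp exp_bounded_const)
  then show ?thesis by (simp add: sinh_def)
qed

lemma exp_bounded_cosh: "exp_bounded (\<lambda>y. cosh y)"
proof -
  have "exp_bounded (\<lambda>y. (1/2) * (exp (1 * y) + exp ((-1) * y)))"
    by (intro exp_bounded_mult exp_bounded_add exp_bounded_diff exp_bounded_exp exp_bounded_const)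
  then show ?thesis by (simp add: cosh_def)
qed

lemmas exp_bounded_intros = exp_bounded_const exp_bounded_id exp_bounded_exp exp_bounded_tanh
  exp_bounded_sinh exp_bounded_cosh exp_bounded_power exp_bounded_mult exp_bounded_add
  exp_bounded_diff

text \<open>
  The Gaussian weight is left unnormalised: only ratios of such integrals occur, so the value of
  \<open>gauss_int c (\<lambda>_. 1)\<close> is irrelevant apart from its sign.
\<close>
definition gauss_int :: "real \<Rightarrow> (real \<Rightarrow> real) \<Rightarrow> real" where
  "gauss_int c f = (\<integral>y. f y * exp (- (c * y\<^sup>2 / 2)) \<partial>lborel)"

lemma gauss_exp_integrable:
  fixes c s :: real
  assumes "c > 0"
  shows "integrable lborel (\<lambda>y. exp (s * y) * exp (- (c * y\<^sup>2 / 2)))"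
proof -
  have "integrable lborel (\<lambda>y. (sqrt (2 * pi / c) * exp (s\<^sup>2 / (2 * c))) *
          normal_density (s / c) (1 / sqrt c) y)"
    using assms by (intro integrable_mult_right integrable_normal_density) auto
  also have "(\<lambda>y. (sqrt (2 * pi / c) * exp (s\<^sup>2 / (2 * c))) * normal_density (s / c) (1 / sqrt c) y)
           = (\<lambda>y. exp (s * y) * exp (- (c * y\<^sup>2 / 2)))"
  proof
    fix y :: real
    have "s\<^sup>2 / (2 * c) - (y - s / c)\<^sup>2 / (2 * (1 / sqrt c)\<^sup>2) = s * y - c * y\<^sup>2 / 2"
      using assms by (simp add: power2_eq_square field_simps)
    then show "(sqrt (2 * pi / c) * exp (s\<^sup>2 / (2 * c))) * normal_density (s / c) (1 / sqrt c) y
        = exp (s * y) * exp (- (c * y\<^sup>2 / 2))"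
      using assms unfolding normal_density_def
      by (simp add: power_divide real_sqrt_divide real_sqrt_mult field_simps flip: exp_add)
  qed
  finally show ?thesis .
qed

lemma gauss_integrable:
  assumes "c > 0" and f: "exp_bounded f"
  shows "integrable lborel (\<lambda>y. f y * exp (- (c * y\<^sup>2 / 2)))"
proof -
  obtain K b where 1: "0 < K" "0 < b" "\<And>y. \<bar>f y\<bar> \<le> K * exp (b * \<bar>y\<bar>)"
    using exp_boundedE[OF f] by metis
  show ?thesis
  proof (rule Bochner_Integration.integrable_bound)
    show "integrable lborel (\<lambda>y. K * (exp (b * y) * exp (- (c * y\<^sup>2 / 2))
            + exp ((-b) * y) * exp (- (c * y\<^sup>2 / 2))))"
      using assms by (intro integrable_mult_right Bochner_Integration.integrable_add gauss_exp_integrable)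
    show "(\<lambda>y. f y * exp (- (c * y\<^sup>2 / 2))) \<in> borel_measurable lborel"
      using f by measurable
    show "AE y in lborel. norm (f y * exp (- (c * y\<^sup>2 / 2))) \<le>
       norm (K * (exp (b * y) * exp (- (c * y\<^sup>2 / 2)) + exp ((-b) * y) * exp (- (c * y\<^sup>2 / 2))))"
    proof (rule AE_I2)
      fix y :: real
      have "exp (b * \<bar>y\<bar>) \<le> exp (b * y) + exp ((-b) * y)"
        by (cases "y \<ge> 0") auto
      then have "\<bar>f y\<bar> \<le> K * (exp (b * y) + exp ((-b) * y))"
        using 1(3)[of y] \<open>0 < K\<close>[THEN less_imp_le] by (meson mult_left_mono order_trans)
      then have "\<bar>f y\<bar> * exp (- (c * y\<^sup>2 / 2)) \<le> K * (exp (b * y) + exp ((-b) * y)) * exp (- (c * y\<^sup>2 / 2))"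
        by (rule mult_right_mono) simp
      then show "norm (f y * exp (- (c * y\<^sup>2 / 2))) \<le>
       norm (K * (exp (b * y) * exp (- (c * y\<^sup>2 / 2)) + exp ((-b) * y) * exp (- (c * y\<^sup>2 / 2))))"
        using \<open>0 < K\<close> by (simp add: abs_mult algebra_simps)
    qed
  qed
qed

lemma gauss_int_add:
  "c > 0 \<Longrightarrow> exp_bounded f \<Longrightarrow> exp_bounded g \<Longrightarrow>
   gauss_int c (\<lambda>y. f y + g y) = gauss_int c f + gauss_int c g"
  unfolding gauss_int_def by (simp add: distrib_right gauss_integrable)

lemma gauss_int_diff:
  "c > 0 \<Longrightarrow> exp_bounded f \<Longrightarrow> exp_bounded g \<Longrightarrow>
   gauss_int c (\<lambda>y. f y - g y) = gauss_int c f - gauss_int c g"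
  unfolding gauss_int_def by (simp add: left_diff_distrib gauss_integrable)

lemma gauss_int_cmult: "gauss_int c (\<lambda>y. r * f y) = r * gauss_int c f"
  unfolding gauss_int_def by (simp add: mult.assoc)

lemma gauss_int_mono:
  "c > 0 \<Longrightarrow> exp_bounded f \<Longrightarrow> exp_bounded g \<Longrightarrow> (\<And>y. f y \<le> g y) \<Longrightarrow>
   gauss_int c f \<le> gauss_int c g"
  unfolding gauss_int_def by (intro integral_mono gauss_integrable) auto

lemma gauss_int_pos:
  assumes "c > 0" and f: "exp_bounded f" and pos: "\<And>y. y \<noteq> 0 \<Longrightarrow> 0 < f y"
  shows "0 < gauss_int c f"
proof -
  have AE0: "AE y::real in lborel. y \<noteq> 0"
    by (rule AE_lborel_singleton)
  have nonneg: "AE y in lborel. 0 \<le> f y * exp (- (c * y\<^sup>2 / 2))"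
    using AE0 by eventually_elim (use pos in \<open>auto intro: less_imp_le\<close>)
  have "gauss_int c f \<noteq> 0"
  proof
    assume "gauss_int c f = 0"
    then have "AE y in lborel. f y * exp (- (c * y\<^sup>2 / 2)) = 0"
      unfolding gauss_int_def
      using integral_nonneg_eq_0_iff_AE[OF gauss_integrable[OF assms(1) f] nonneg] by simp
    with AE0 have "AE y::real in lborel. False"
      by eventually_elim (use pos in fastforce)
    then show False by (simp add: AE_iff_measurable[where N = UNIV])
  qed
  moreover have "0 \<le> gauss_int c f"
    unfolding gauss_int_def by (rule integral_nonneg_AE[OF nonneg])
  ultimately show ?thesis by simp
qed

text \<open>
  Completing the square.
\<close>
lemma gauss_int_exp_shift:
  "gauss_int c (\<lambda>y. exp (c * a * y) * f y) = exp (c * a\<^sup>2 / 2) * gauss_int c (\<lambda>z. f (z + a))"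
proof -
  have "gauss_int c (\<lambda>y. exp (c * a * y) * f y)
      = (\<integral>z. exp (c * a * (a + z)) * f (a + z) * exp (- (c * (a + z)\<^sup>2 / 2)) \<partial>lborel)"
    unfolding gauss_int_def
    using lborel_integral_real_affine[of 1 "\<lambda>y. exp (c * a * y) * f y * exp (- (c * y\<^sup>2 / 2))" a]
    by simp
  also have "\<dots> = (\<integral>z. exp (c * a\<^sup>2 / 2) * (f (z + a) * exp (- (c * z\<^sup>2 / 2))) \<partial>lborel)"
  proof (rule Bochner_Integration.integral_cong)
    fix z :: real
    have "exp (c * a * (a + z)) * exp (- (c * (a + z)\<^sup>2 / 2)) = exp (c * a\<^sup>2 / 2) * exp (- (c * z\<^sup>2 / 2))"
      unfolding exp_add[symmetric] by (rule arg_cong[of _ _ exp]) (simp add: power2_eq_square algebra_simps add_divide_distrib)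
    then show "exp (c * a * (a + z)) * f (a + z) * exp (- (c * (a + z)\<^sup>2 / 2))
       = exp (c * a\<^sup>2 / 2) * (f (z + a) * exp (- (c * z\<^sup>2 / 2)))"
      by (simp add: add.commute mult_ac)
  qed simp
  finally show ?thesis by (simp add: gauss_int_def)
qed

lemma gauss_decay:
  assumes "c > 0" and f: "exp_bounded f"
  shows "((\<lambda>y. f y * exp (- (c * y\<^sup>2 / 2))) \<longlongrightarrow> 0) at_top"
    and "((\<lambda>y. f y * exp (- (c * y\<^sup>2 / 2))) \<longlongrightarrow> 0) at_bot"
proof -
  obtain K b where 1: "0 < K" "0 < b" "\<And>y. \<bar>f y\<bar> \<le> K * exp (b * \<bar>y\<bar>)"
    using exp_boundedE[OF f] by metis
  have le: "norm (f y * exp (- (c * y\<^sup>2 / 2))) \<le> K * exp (b * \<bar>y\<bar>) * exp (- (c * \<bar>y\<bar>\<^sup>2 / 2))" for y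
    using 1(3)[of y] by (simp add: abs_mult)
  have top: "((\<lambda>x. K * exp (b * x) * exp (- (c * x\<^sup>2 / 2))) \<longlongrightarrow> 0) at_top"
    using \<open>c > 0\<close> 1(1,2) by real_asymp
  have "((\<lambda>y. K * exp (b * \<bar>y\<bar>) * exp (- (c * \<bar>y\<bar>\<^sup>2 / 2))) \<longlongrightarrow> 0) at_top"
    by (rule filterlim_compose[OF top]) (rule filterlim_abs_real)
  then show "((\<lambda>y. f y * exp (- (c * y\<^sup>2 / 2))) \<longlongrightarrow> 0) at_top"
    by (rule Lim_null_comparison[rotated]) (use le in \<open>auto intro!: always_eventually\<close>)
  have "((\<lambda>y. K * exp (b * \<bar>y\<bar>) * exp (- (c * \<bar>y\<bar>\<^sup>2 / 2))) \<longlongrightarrow> 0) at_bot"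
    by (rule filterlim_compose[OF top]) (real_asymp)
  then show "((\<lambda>y. f y * exp (- (c * y\<^sup>2 / 2))) \<longlongrightarrow> 0) at_bot"
    by (rule Lim_null_comparison[rotated]) (use le in \<open>auto intro!: always_eventually\<close>)
qed

lemma gauss_int_by_parts:
  assumes c: "c > 0" and F: "exp_bounded F" and F': "exp_bounded F'"
    and deriv: "\<And>y. (F has_real_derivative F' y) (at y)"
    and cont: "continuous_on UNIV F'"
  shows "gauss_int c F' = c * gauss_int c (\<lambda>y. y * F y)"
proof -
  let ?G = "\<lambda>y. F y * exp (- (c * y\<^sup>2 / 2))"
  let ?g = "\<lambda>y. (F' y - c * (y * F y)) * exp (- (c * y\<^sup>2 / 2))"
  have bnd: "exp_bounded (\<lambda>y. c * (y * F y))"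
    by (intro exp_bounded_mult exp_bounded_const exp_bounded_id F)
  have int: "integrable lborel ?g"
    by (intro gauss_integrable c exp_bounded_diff F' bnd)
  have contF: "continuous_on UNIV F"
    by (rule DERIV_continuous_on) (use deriv in auto)
  have "(LBINT y=-\<infinity>..\<infinity>. ?g y) = 0 - 0"
  proof (rule interval_integral_FTC_integrable)
    show "(?G has_vector_derivative ?g y) (at y)" for y
    proof -
      have "((\<lambda>y. exp (- (c * y\<^sup>2 / 2))) has_real_derivative - (c * y) * exp (- (c * y\<^sup>2 / 2))) (at y)"
        by (auto intro!: derivative_eq_intros)
      from DERIV_mult[OF deriv this] show ?thesis
        unfolding has_real_derivative_iff_has_vector_derivative[symmetric]
        by (simp add: algebra_simps)
    qed
    have "continuous_on UNIV ?g"
      by (intro continuous_intros cont contF) auto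
    then show "isCont ?g y" for y
      using continuous_on_eq_continuous_at open_UNIV by blast
    show "set_integrable lborel (einterval (-\<infinity>) \<infinity>) ?g"
      using int by (simp add: set_integrable_def)
    show "((?G \<circ> real_of_ereal) \<longlongrightarrow> 0) (at_right (-\<infinity>))"
      using gauss_decay(2)[OF c F] by (simp add: ereal_tendsto_simps)
    show "((?G \<circ> real_of_ereal) \<longlongrightarrow> 0) (at_left \<infinity>)"
      using gauss_decay(1)[OF c F] by (simp add: ereal_tendsto_simps)
  qed simp
  then have "gauss_int c (\<lambda>y. F' y - c * (y * F y)) = 0"
    by (simp add: gauss_int_def interval_lebesgue_integral_def set_lebesgue_integral_def)
  then show ?thesis
    using gauss_int_diff[OF c F' bnd] by (simp add: gauss_int_cmult)
qed

lemma gauss_int_moment: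
  assumes "c > 0"
  shows "gauss_int c (\<lambda>z. z ^ (n + 2)) = (real n + 1) / c * gauss_int c (\<lambda>z. z ^ n)"
proof -
  have "gauss_int c (\<lambda>z. (real n + 1) * z ^ n) = c * gauss_int c (\<lambda>z. z * (z * z ^ n))"
  proof (rule gauss_int_by_parts[OF assms])
    show "((\<lambda>z. z * z ^ n) has_real_derivative (real n + 1) * z ^ n) (at z)" for z :: real
      using DERIV_pow[of "Suc n" z] by (simp add: algebra_simps)
  qed (intro exp_bounded_intros continuous_intros)+
  then show ?thesis
    using assms unfolding gauss_int_cmult by (simp add: field_simps)
qed

lemma gauss_int_exp: "gauss_int c (\<lambda>z. exp (c * a * z)) = exp (c * a\<^sup>2 / 2) * gauss_int c (\<lambda>_. 1)"
  using gauss_int_exp_shift[of c a "\<lambda>_. 1"] by simp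

lemma gauss_int_low_moments:
  assumes "c > 0"
  shows "gauss_int c (\<lambda>z. z) = 0"
    and "gauss_int c (\<lambda>z. z\<^sup>2) = 1 / c * gauss_int c (\<lambda>_. 1)"
    and "gauss_int c (\<lambda>z. z ^ 4) = 3 / c\<^sup>2 * gauss_int c (\<lambda>_. 1)"
    and "gauss_int c (\<lambda>z. z ^ 6) = 15 / c ^ 3 * gauss_int c (\<lambda>_. 1)"
proof -
  have "gauss_int c (\<lambda>_. 0) = c * gauss_int c (\<lambda>y. y * 1)"
    by (rule gauss_int_by_parts[OF assms]) (auto intro: exp_bounded_intros)
  then show "gauss_int c (\<lambda>z. z) = 0"
    using assms by (simp add: gauss_int_def)
  show 2: "gauss_int c (\<lambda>z. z\<^sup>2) = 1 / c * gauss_int c (\<lambda>_. 1)"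
    using gauss_int_moment[OF assms, of 0] by (simp add: numeral_2_eq_2)
  show 4: "gauss_int c (\<lambda>z. z ^ 4) = 3 / c\<^sup>2 * gauss_int c (\<lambda>_. 1)"
    using gauss_int_moment[OF assms, of 2] 2 by (simp add: power2_eq_square)
  show "gauss_int c (\<lambda>z. z ^ 6) = 15 / c ^ 3 * gauss_int c (\<lambda>_. 1)"
    using gauss_int_moment[OF assms, of 4] 4 by (simp add: eval_nat_numeral)
qed

lemma gauss_int_sinh_square:
  assumes "c > 0"
  shows "gauss_int c (\<lambda>z. (sinh z)\<^sup>2) = (exp (2 / c) - 1) / 2 * gauss_int c (\<lambda>_. 1)"
proof -
  have e: "gauss_int c (\<lambda>z. exp (t * z)) = exp (t\<^sup>2 / (2 * c)) * gauss_int c (\<lambda>_. 1)" for t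
    using gauss_int_exp[of c "t / c"] assms by (simp add: power2_eq_square)
  have "(\<lambda>z::real. (sinh z)\<^sup>2) = (\<lambda>z. 1 / 4 * ((exp (2 * z) + exp (-2 * z)) - 2 * 1))"
  proof
    fix z :: real
    show "(sinh z)\<^sup>2 = 1 / 4 * ((exp (2 * z) + exp (-2 * z)) - 2 * 1)"
      by (simp add: sinh_def power2_eq_square algebra_simps flip: exp_add)
  qed
  then have "gauss_int c (\<lambda>z. (sinh z)\<^sup>2)
      = 1 / 4 * ((gauss_int c (\<lambda>z. exp (2 * z)) + gauss_int c (\<lambda>z. exp (-2 * z)))
          - 2 * gauss_int c (\<lambda>_. 1))"
    using assms by (simp only: gauss_int_cmult gauss_int_diff gauss_int_add exp_bounded_intros)
  then show ?thesis by (simp only: e) (simp add: field_simps)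
qed

section \<open>The quartic factor and the Gaussian representation\<close>

text \<open>
  The factor \<open>cosh y ^ n\<close> produced by \<open>n\<close> summed-out spins, divided by its Gaussian approximation
  \<open>exp (n y\<^sup>2 / 2)\<close>. Near \<open>0\<close> it behaves like \<open>exp (- n y\<^sup>4 / 12)\<close>.
\<close>
definition quartic_factor :: "nat \<Rightarrow> real \<Rightarrow> real" where
  "quartic_factor n y = (cosh y * exp (- (y\<^sup>2 / 2))) ^ n"

lemma quartic_factor_deriv:
  "(quartic_factor n has_real_derivative real n * (tanh y - y) * quartic_factor n y) (at y)"
proof -
  have "((\<lambda>y. (cosh y * exp (- (y\<^sup>2 / 2))) ^ n) has_real_derivative
     real n * (cosh y * exp (- (y\<^sup>2 / 2))) ^ (n - 1) * ((tanh y - y) * (cosh y * exp (- (y\<^sup>2 / 2))))) (at y)"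
    using DERIV_power[OF cosh_times_gauss_deriv, where n = n] by (simp add: mult_ac)
  moreover have "real n * x ^ (n - 1) * (t * x) = real n * t * x ^ n" for x t :: real
    by (cases n) auto
  ultimately show ?thesis unfolding quartic_factor_def[abs_def] by metis
qed

lemma quartic_factor_pos: "0 < quartic_factor n y"
  by (simp add: quartic_factor_def)

lemma quartic_factor_le_1: "quartic_factor n y \<le> 1"
  unfolding quartic_factor_def using cosh_le_exp_half_square[of y]
  by (intro power_le_one) (auto simp: exp_minus field_simps)

text \<open>
  From \<open>cosh y \<ge> 1 + y\<^sup>2 / 2\<close> and \<open>exp (- y\<^sup>2 / 2) \<ge> 1 - y\<^sup>2 / 2\<close>, followed by Bernoulli's inequality.
\<close>
lemma quartic_factor_ge: "1 - real n * y ^ 4 / 4 \<le> quartic_factor n y"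
proof (cases "n = 0 \<or> y ^ 4 \<le> 4")
  case False
  then have "4 \<le> real n * y ^ 4"
    using mult_mono[of 1 "real n" 4 "y ^ 4"] by simp
  then show ?thesis using quartic_factor_pos[of n y] by linarith
next
  case True
  have base: "1 - y ^ 4 / 4 \<le> cosh y * exp (- (y\<^sup>2 / 2))"
  proof -
    have "1 - y ^ 4 / 4 = (1 + y\<^sup>2 / 2) * (1 - y\<^sup>2 / 2)"
      by (simp add: eval_nat_numeral field_simps)
    also have "\<dots> \<le> (1 + y\<^sup>2 / 2) * exp (- (y\<^sup>2 / 2))"
      using exp_ge_add_one_self[of "- (y\<^sup>2 / 2)"] by (intro mult_left_mono) auto
    also have "\<dots> \<le> cosh y * exp (- (y\<^sup>2 / 2))"
      by (intro mult_right_mono cosh_ge_quadratic) auto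
    finally show ?thesis .
  qed
  show ?thesis
  proof (cases "n = 0")
    case True
    then show ?thesis by (simp add: quartic_factor_def)
  next
    case False
    with True have "y ^ 4 \<le> 4" by simp
    then have "1 + real n * (- (y ^ 4 / 4)) \<le> (1 + - (y ^ 4 / 4)) ^ n"
      by (intro Bernoulli_inequality) simp
    also have "\<dots> \<le> quartic_factor n y"
      unfolding quartic_factor_def using base \<open>y ^ 4 \<le> 4\<close> by (intro power_mono) auto
    finally show ?thesis by simp
  qed
qed

lemma continuous_on_quartic_factor [continuous_intros]:
  "continuous_on S f \<Longrightarrow> continuous_on S (\<lambda>x. quartic_factor n (f x))"
  unfolding quartic_factor_def by (intro continuous_intros) auto

lemma exp_bounded_quartic_factor: "exp_bounded (\<lambda>z. quartic_factor n (z + a))"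
proof (rule exp_boundedI[where K = 1 and b = 0])
  show "(\<lambda>z. quartic_factor n (z + a)) \<in> borel_measurable borel"
    by (intro borel_measurable_continuous_onI continuous_intros)
  show "\<bar>quartic_factor n (z + a)\<bar> \<le> 1 * exp (0 * \<bar>z\<bar>)" for z
    using quartic_factor_le_1[of n "z + a"] quartic_factor_pos[of n "z + a"] by simp
qed

text \<open>
  The Hubbard-Stratonovich transform: \<open>exp (s\<^sup>2 / 2N)\<close> is the normalised Gaussian integral of
  \<open>exp (s y)\<close> with precision \<open>N\<close>, and one step of the walk multiplies \<open>exp (s y)\<close> by \<open>cosh y\<close>. Moving
  \<open>exp (n y\<^sup>2 / 2)\<close> from \<open>cosh y ^ n\<close> into the weight lowers the precision from \<open>N\<close> to \<open>N - n\<close>.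
\<close>
lemma cw_average_gauss:
  assumes "n < N"
  defines "c \<equiv> real (N - n)"
  shows "gauss_int c (\<lambda>y. quartic_factor n y * exp (s * y))
         = cw_average N n s * gauss_int (real N) (\<lambda>_. 1)"
proof -
  have N: "real N > 0" using assms by simp
  have "gauss_int (real N) (\<lambda>y. cosh y ^ n * exp (s * y)) = cw_average N n s * gauss_int (real N) (\<lambda>_. 1)"
  proof (induction n arbitrary: s)
    case 0
    show ?case using gauss_int_exp[of "real N" "s / real N"] N by (simp add: power2_eq_square)
  next
    case (Suc n)
    have "(\<lambda>y::real. cosh y ^ Suc n * exp (s * y))
        = (\<lambda>y. 1 / 2 * (cosh y ^ n * exp ((s + 1) * y) + cosh y ^ n * exp ((s - 1) * y)))"
      by (simp add: fun_eq_iff cosh_def exp_add exp_diff exp_minus field_simps)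
    then have "gauss_int (real N) (\<lambda>y. cosh y ^ Suc n * exp (s * y))
       = 1 / 2 * (gauss_int (real N) (\<lambda>y. cosh y ^ n * exp ((s + 1) * y))
           + gauss_int (real N) (\<lambda>y. cosh y ^ n * exp ((s - 1) * y)))"
      using N by (simp only: gauss_int_cmult gauss_int_add exp_bounded_intros)
    then show ?case unfolding Suc by (simp add: field_simps)
  qed
  moreover have "gauss_int c (\<lambda>y. quartic_factor n y * exp (s * y))
       = gauss_int (real N) (\<lambda>y. cosh y ^ n * exp (s * y))"
    unfolding gauss_int_def
  proof (rule Bochner_Integration.integral_cong)
    fix y :: real
    have "exp (- (y\<^sup>2 / 2)) ^ n * exp (- (c * y\<^sup>2 / 2)) = exp (- (real N * y\<^sup>2 / 2))"
      using assms by (simp add: of_nat_diff algebra_simps flip: exp_of_nat_mult exp_add)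
    then show "quartic_factor n y * exp (s * y) * exp (- (c * y\<^sup>2 / 2))
        = cosh y ^ n * exp (s * y) * exp (- (real N * y\<^sup>2 / 2))"
      by (simp add: quartic_factor_def power_mult_distrib mult_ac)
  qed simp
  ultimately show ?thesis by simp
qed

text \<open>
  The tilt \<open>exp (s y)\<close> with \<open>s = c a\<close> is absorbed into the Gaussian weight by moving its centre to \<open>a\<close>.
\<close>
lemma cw_average_shift:
  assumes "n < N"
  defines "c \<equiv> real (N - n)"
  shows "cw_average N n (c * a + t) * gauss_int (real N) (\<lambda>_. 1)
     = exp (c * a\<^sup>2 / 2) * exp (t * a) * gauss_int c (\<lambda>z. quartic_factor n (z + a) * exp (t * z))"
proof -
  have "cw_average N n (c * a + t) * gauss_int (real N) (\<lambda>_. 1)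
      = gauss_int c (\<lambda>y. exp (c * a * y) * (quartic_factor n y * exp (t * y)))"
  proof -
    have "exp ((c * a + t) * y) = exp (c * a * y) * exp (t * y)" for y
      unfolding distrib_right exp_add ..
    then show ?thesis
      unfolding c_def cw_average_gauss[OF assms(1), symmetric] by (simp add: mult_ac)
  qed
  also have "\<dots> = exp (c * a\<^sup>2 / 2) * gauss_int c (\<lambda>z. exp (t * a) * (quartic_factor n (z + a) * exp (t * z)))"
    unfolding gauss_int_exp_shift by (simp add: distrib_left exp_add mult_ac)
  finally show ?thesis by (simp add: gauss_int_cmult)
qed

lemma gauss_int_two_sided_tilt:
  assumes "c > 0"
  shows "gauss_int c (\<lambda>z. quartic_factor n (z + a) * exp (2 * z))
       + gauss_int c (\<lambda>z. quartic_factor n (z + a) * exp (- 2 * z))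
       = 2 * gauss_int c (\<lambda>z. quartic_factor n (z + a))
         + 4 * gauss_int c (\<lambda>z. quartic_factor n (z + a) * (sinh z)\<^sup>2)"
proof -
  note bnd = exp_bounded_quartic_factor exp_bounded_intros
  have "(\<lambda>z. quartic_factor n (z + a) * exp (2 * z) + quartic_factor n (z + a) * exp (- 2 * z))
      = (\<lambda>z. 2 * quartic_factor n (z + a) + 4 * (quartic_factor n (z + a) * (sinh z)\<^sup>2))"
  proof
    fix z :: real
    have "exp (2 * z) + exp (- 2 * z) = 2 + 4 * (sinh z)\<^sup>2"
      by (simp add: sinh_def power2_eq_square field_simps flip: exp_add)
    then show "quartic_factor n (z + a) * exp (2 * z) + quartic_factor n (z + a) * exp (- 2 * z)
      = 2 * quartic_factor n (z + a) + 4 * (quartic_factor n (z + a) * (sinh z)\<^sup>2)"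
      by (simp only: distrib_left[symmetric]) (simp add: algebra_simps)
  qed
  then show ?thesis
    using assms by (simp only: gauss_int_cmult[symmetric] gauss_int_add[symmetric] bnd)
qed

section \<open>Log-concavity for windows shorter than half\<close>

text \<open>
  Integration by parts applied to \<open>(z - (n/c) (y - tanh y)) \<psi>(y)\<close> with \<open>y = z + a\<close> and \<open>\<psi>\<close> the quartic
  factor. The correction \<open>(n/c) (y - tanh y)\<close> is the logarithmic derivative of \<open>\<psi>\<close> divided by \<open>- c\<close>; it
  cancels the mixed terms \<open>z (y - tanh y)\<close>, whose sign is not controlled.
\<close>
lemma shifted_integration_by_parts:
  assumes c: "c > 0"
  shows "gauss_int c (\<lambda>z. quartic_factor n (z + a) * (1 - c * z\<^sup>2 - real n / c * (tanh (z + a))\<^sup>2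
            + (real n)\<^sup>2 / c * (z + a - tanh (z + a))\<^sup>2)) = 0"
proof -
  let ?Q = "\<lambda>z. quartic_factor n (z + a)" and ?T = "\<lambda>z. tanh (z + a)"
  note bnd = exp_bounded_quartic_factor exp_bounded_intros
  define r where "r = real n / c"
  define F where "F = (\<lambda>z. (z - r * (z + a - ?T z)) * ?Q z)"
  define F' where "F' = (\<lambda>z. (1 - r * (?T z)\<^sup>2) * ?Q z
      + (z - r * (z + a - ?T z)) * (real n * (?T z - (z + a)) * ?Q z))"
  have F: "exp_bounded F" and F': "exp_bounded F'"
    unfolding F_def F'_def by (intro bnd)+
  have "gauss_int c F' = c * gauss_int c (\<lambda>z. z * F z)"
  proof (rule gauss_int_by_parts[OF c F F'])
    fix z :: real
    have Q: "(?Q has_real_derivative real n * (?T z - (z + a)) * ?Q z) (at z)"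
      using DERIV_shift[of "quartic_factor n" _ z a] quartic_factor_deriv by blast
    have "((\<lambda>z. z - r * (z + a - ?T z)) has_real_derivative 1 - r * (?T z)\<^sup>2) (at z)"
      by (auto intro!: derivative_eq_intros)
    from DERIV_mult[OF this Q] show "(F has_real_derivative F' z) (at z)"
      unfolding F_def F'_def by (simp add: algebra_simps)
    show "continuous_on UNIV F'" unfolding F'_def by (intro continuous_intros) auto
  qed
  then have "gauss_int c (\<lambda>z. F' z - c * (z * F z)) = 0"
    using gauss_int_diff[OF c F', of "\<lambda>z. c * (z * F z)"] F
    by (simp add: gauss_int_cmult exp_bounded_intros)
  also have "(\<lambda>z. F' z - c * (z * F z)) = (\<lambda>z. quartic_factor n (z + a) * (1 - c * z\<^sup>2
      - real n / c * (tanh (z + a))\<^sup>2 + (real n)\<^sup>2 / c * (z + a - tanh (z + a))\<^sup>2))"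
  proof
    fix z
    have rc: "r * c = real n" using c by (simp add: r_def)
    have "F' z - c * (z * F z) = ?Q z * (1 - c * z\<^sup>2 - r * (?T z)\<^sup>2 + r * real n * (z + a - ?T z)\<^sup>2
        + (r * c - real n) * (z * (z + a - ?T z)))"
      by (simp add: F_def F'_def power2_eq_square algebra_simps)
    then show "F' z - c * (z * F z) = quartic_factor n (z + a) * (1 - c * z\<^sup>2
      - real n / c * (tanh (z + a))\<^sup>2 + (real n)\<^sup>2 / c * (z + a - tanh (z + a))\<^sup>2)"
      by (simp add: rc) (simp add: r_def power2_eq_square)
  qed
  finally show ?thesis .
qed

text \<open>
  Adding the vanishing integral of \<open>shifted_integration_by_parts\<close> to
  \<open>\<integral> \<psi> (c sinh\<^sup>2 z - 1)\<close> cancels the quadratic part of \<open>c sinh\<^sup>2 z\<close>. What is left is, with \<open>y = z + a\<close>, \<open>c (sinh\<^sup>2 z - z\<^sup>2)\<close>, of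
  mean about \<open>1/c\<close>, minus \<open>(n/c) tanh\<^sup>2 y\<close>, of mean at least about \<open>n/c\<^sup>2 \<ge> (1 + \<delta>)/c\<close>, and
  errors of order \<open>1/c\<^sup>2\<close>. The last hypothesis lets the gap \<open>\<delta>/c\<close> absorb these errors; its constants come
  from the crude bounds on \<open>exp (2/c)\<close>, \<open>(z + a)\<^sup>4\<close> and \<open>(z + a)\<^sup>6\<close>.
\<close>
lemma sinh_moment_le:
  fixes \<delta> K c a :: real
  assumes c: "2 \<le> c" and n_ge: "(1 + \<delta>) * c \<le> real n" and n_le: "real n \<le> K * c"
    and a: "a\<^sup>2 \<le> 3 / c" and large: "4 + 64 * K + 486 * K\<^sup>2 \<le> \<delta> * c"
  shows "c * gauss_int c (\<lambda>z. quartic_factor n (z + a) * (sinh z)\<^sup>2)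
         \<le> gauss_int c (\<lambda>z. quartic_factor n (z + a))"
proof -
  let ?Q = "\<lambda>z. quartic_factor n (z + a)" and ?T = "\<lambda>z. tanh (z + a)"
  let ?G = "gauss_int c (\<lambda>_. 1)"
  note bnd = exp_bounded_quartic_factor exp_bounded_intros
  have c0: "c > 0" using c by simp
  have G: "?G > 0" by (intro gauss_int_pos c0 exp_bounded_const) auto
  define A where "A = 16 * real n / (3 * c)"
  define B where "B = 104 * (real n)\<^sup>2 / (9 * c)"
  \<comment> \<open>\<open>U\<close> is a majorant of the integrand whose Gaussian integral is explicit; \<open>A\<close> and \<open>B\<close> collect the
      errors made by replacing \<open>\<psi>\<close>, \<open>tanh\<^sup>2 y\<close> and \<open>(y - tanh y)\<^sup>2\<close> by polynomials.\<close>
  define U where "U = (\<lambda>z. c * (sinh z)\<^sup>2 - (c + real n / c) * z\<^sup>2 - 2 * a * real n / c * z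
      + A * z ^ 4 + B * z ^ 6 + (A * a ^ 4 + B * a ^ 6 - real n / c * a\<^sup>2) * 1)"
  define I where "I = (\<lambda>z. ?Q z * (1 - c * z\<^sup>2 - real n / c * (?T z)\<^sup>2
            + (real n)\<^sup>2 / c * (z + a - ?T z)\<^sup>2))"
  have I: "exp_bounded I" and U: "exp_bounded U"
    unfolding I_def U_def by (intro bnd)+
  have pointwise: "c * (?Q z * (sinh z)\<^sup>2) - ?Q z + I z \<le> U z" for z
  proof -
    define y where "y = z + a"
    have Q01: "0 \<le> ?Q z" "?Q z \<le> 1"
      using quartic_factor_pos quartic_factor_le_1 by (auto intro: less_imp_le)
    have y4: "y ^ 4 \<le> 8 * (z ^ 4 + a ^ 4)" and y6: "y ^ 6 \<le> 32 * (z ^ 6 + a ^ 6)"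
      unfolding y_def by (rule fourth_power_add_le sixth_power_add_le)+
    have sinh2: "?Q z * (c * ((sinh z)\<^sup>2 - z\<^sup>2)) \<le> c * ((sinh z)\<^sup>2 - z\<^sup>2)"
    proof (rule mult_left_le_one_le)
      have "0 \<le> (sinh z)\<^sup>2 - z\<^sup>2" using sinh_square_ge[of z] by (smt (verit) zero_le_even_power even_numeral zero_le_divide_iff)
      then show "0 \<le> c * ((sinh z)\<^sup>2 - z\<^sup>2)" using c0 by simp
    qed (use Q01 in auto)
    have "?Q z * (y - tanh y)\<^sup>2 \<le> (y - tanh y)\<^sup>2"
      using Q01 by (intro mult_left_le_one_le) auto
    also have "\<dots> \<le> y ^ 6 / 9" by (rule tanh_defect_square_le)
    finally have d: "(real n)\<^sup>2 / c * (?Q z * (y - tanh y)\<^sup>2) \<le> (real n)\<^sup>2 / c * (y ^ 6 / 9)"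
      using c0 by (intro mult_left_mono) auto
    have "y\<^sup>2 - 2 / 3 * y ^ 4 - real n / 4 * y ^ 6 \<le> (tanh y)\<^sup>2 - real n * y ^ 4 / 4 * (tanh y)\<^sup>2"
    proof -
      have "real n * y ^ 4 / 4 * (tanh y)\<^sup>2 \<le> real n * y ^ 4 / 4 * y\<^sup>2"
        by (intro mult_left_mono tanh_square_le) auto
      also have "\<dots> = real n / 4 * y ^ 6" by (simp add: eval_nat_numeral)
      finally show ?thesis using tanh_square_ge[of y] by linarith
    qed
    also have "\<dots> = (1 - real n * y ^ 4 / 4) * (tanh y)\<^sup>2" by (simp add: algebra_simps)
    also have "\<dots> \<le> ?Q z * (tanh y)\<^sup>2"
      unfolding y_def by (intro mult_right_mono quartic_factor_ge) auto
    finally have t: "real n / c * (y\<^sup>2 - 2 / 3 * y ^ 4 - real n / 4 * y ^ 6)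
        \<le> real n / c * (?Q z * (tanh y)\<^sup>2)"
      using c0 by (intro mult_left_mono) auto
    have "c * (?Q z * (sinh z)\<^sup>2) - ?Q z + I z
        = ?Q z * (c * ((sinh z)\<^sup>2 - z\<^sup>2)) - real n / c * (?Q z * (tanh y)\<^sup>2)
          + (real n)\<^sup>2 / c * (?Q z * (y - tanh y)\<^sup>2)"
      by (simp add: I_def y_def algebra_simps)
    also have "\<dots> \<le> c * ((sinh z)\<^sup>2 - z\<^sup>2)
        - real n / c * (y\<^sup>2 - 2 / 3 * y ^ 4 - real n / 4 * y ^ 6) + (real n)\<^sup>2 / c * (y ^ 6 / 9)"
      using sinh2 d t by linarith
    also have "\<dots> = c * ((sinh z)\<^sup>2 - z\<^sup>2) - real n / c * y\<^sup>2 + A / 8 * y ^ 4 + B / 32 * y ^ 6"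
      using c0 by (simp add: A_def B_def power2_eq_square field_simps)
    also have "\<dots> \<le> c * ((sinh z)\<^sup>2 - z\<^sup>2) - real n / c * y\<^sup>2
        + A / 8 * (8 * (z ^ 4 + a ^ 4)) + B / 32 * (32 * (z ^ 6 + a ^ 6))"
      using c0 by (intro add_mono mult_left_mono y4 y6 order_refl) (auto simp: A_def B_def)
    also have "\<dots> = U z"
      by (simp add: U_def y_def power2_eq_square algebra_simps add_divide_distrib)
    finally show ?thesis .
  qed
  have "c * gauss_int c (\<lambda>z. ?Q z * (sinh z)\<^sup>2) - gauss_int c ?Q + gauss_int c I
      = gauss_int c (\<lambda>z. c * (?Q z * (sinh z)\<^sup>2) - ?Q z + I z)"
    using c0 I by (simp only: gauss_int_cmult gauss_int_diff gauss_int_add bnd)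
  also have "\<dots> \<le> gauss_int c U"
    by (rule gauss_int_mono[OF c0 _ U pointwise]) (intro bnd I)
  also have "\<dots> = c * gauss_int c (\<lambda>z. (sinh z)\<^sup>2) - (c + real n / c) * gauss_int c (\<lambda>z. z\<^sup>2)
      - 2 * a * real n / c * gauss_int c (\<lambda>z. z) + A * gauss_int c (\<lambda>z. z ^ 4)
      + B * gauss_int c (\<lambda>z. z ^ 6) + (A * a ^ 4 + B * a ^ 6 - real n / c * a\<^sup>2) * ?G"
    unfolding U_def using c0 by (simp only: gauss_int_cmult gauss_int_diff gauss_int_add bnd)
  also have "\<dots> = (c * ((exp (2 / c) - 1) / 2) - (c + real n / c) * (1 / c)
      + A * (3 / c\<^sup>2) + B * (15 / c ^ 3) + (A * a ^ 4 + B * a ^ 6 - real n / c * a\<^sup>2)) * ?G"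
    by (simp only: gauss_int_sinh_square[OF c0] gauss_int_low_moments[OF c0])
      (simp only: algebra_simps mult_zero_right diff_0_right add_0_right add_0_left)
  also have "\<dots> \<le> 0"
  proof -
    have K: "0 \<le> K"
      using n_le c0 by (smt (verit) mult_neg_pos of_nat_0_le_iff)
    have "exp (2 / c) \<le> 1 + 2 / c + (2 / c)\<^sup>2 / 2 + (2 / c) ^ 3"
      using c by (intro exp_le_cubic) auto
    then have "c * ((exp (2 / c) - 1) / 2) \<le> c * ((2 / c + (2 / c)\<^sup>2 / 2 + (2 / c) ^ 3) / 2)"
      using c0 by (intro mult_left_mono) auto
    also have "\<dots> = 1 + 1 / c + 4 / c\<^sup>2"
      using c0 by (simp add: eval_nat_numeral field_simps)
    finally have e: "c * ((exp (2 / c) - 1) / 2) \<le> 1 + 1 / c + 4 / c\<^sup>2" .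
    have nc: "1 + \<delta> \<le> real n / c" "real n / c \<le> K"
      using n_ge n_le c0 by (auto simp: field_simps)
    have n1: "(1 + \<delta>) * (1 / c) \<le> real n / c * (1 / c)"
      using nc c0 by (intro mult_right_mono) auto
    have A: "0 \<le> A" "A \<le> 16 / 3 * K" using nc c0 by (auto simp: A_def)
    have "real n * (real n / c) \<le> (K * c) * K"
      using n_le nc c0 K by (intro mult_mono) auto
    then have B: "0 \<le> B" "B \<le> 104 / 9 * K\<^sup>2 * c"
      using c0 by (auto simp: B_def power2_eq_square field_simps)
    have "(a\<^sup>2)\<^sup>2 \<le> (3 / c)\<^sup>2" by (intro power_mono a) auto
    then have a4: "a ^ 4 \<le> 9 / c\<^sup>2" by (simp add: power_divide flip: power_mult)
    have "(a\<^sup>2) ^ 3 \<le> (3 / c) ^ 3" by (intro power_mono a) auto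
    then have a6: "a ^ 6 \<le> 27 / c ^ 3" by (simp add: power_divide flip: power_mult)
    have "A * (3 / c\<^sup>2 + a ^ 4) \<le> 16 / 3 * K * (12 / c\<^sup>2)"
    proof (rule mult_mono)
      show "3 / c\<^sup>2 + a ^ 4 \<le> 12 / c\<^sup>2"
        using a4 by (simp add: add_divide_distrib[symmetric] field_simps)
    qed (use A K in auto)
    moreover have "B * (15 / c ^ 3 + a ^ 6) \<le> 104 / 9 * K\<^sup>2 * c * (42 / c ^ 3)"
    proof (rule mult_mono)
      show "15 / c ^ 3 + a ^ 6 \<le> 42 / c ^ 3"
        using a6 by (simp add: add_divide_distrib[symmetric] field_simps)
    qed (use B c0 K in auto)
    moreover have "104 / 9 * K\<^sup>2 * c * (42 / c ^ 3) \<le> 486 * K\<^sup>2 / c\<^sup>2"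
      using c0 by (simp add: eval_nat_numeral field_simps mult_left_mono)
    moreover have "0 \<le> real n / c * a\<^sup>2" using c0 by simp
    moreover have "(c + real n / c) * (1 / c) = 1 + real n / c * (1 / c)"
      using c0 by (simp add: field_simps)
    ultimately have "c * ((exp (2 / c) - 1) / 2) - (c + real n / c) * (1 / c)
      + A * (3 / c\<^sup>2) + B * (15 / c ^ 3) + (A * a ^ 4 + B * a ^ 6 - real n / c * a\<^sup>2)
      \<le> 1 / c + 4 / c\<^sup>2 - (1 + \<delta>) * (1 / c) + 16 / 3 * K * (12 / c\<^sup>2) + 486 * K\<^sup>2 / c\<^sup>2"
      using e n1 by (simp add: distrib_left)
    also have "\<dots> = (4 + 64 * K + 486 * K\<^sup>2 - \<delta> * c) / c\<^sup>2"
      using c0 by (simp add: power2_eq_square field_simps)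
    also have "\<dots> \<le> 0" using large by (simp add: divide_nonpos_nonneg)
    finally show ?thesis using G by (simp add: mult_nonpos_nonneg)
  qed
  finally show ?thesis
    using shifted_integration_by_parts[OF c0, of n a] by (simp add: I_def)
qed

text \<open>
  After recentring at \<open>a = s/c\<close>, the values \<open>w(s + 2)\<close> and \<open>w(s - 2)\<close> are integrals of
  \<open>\<psi>(z + a) exp (2z)\<close> and \<open>\<psi>(z + a) exp (-2z)\<close>. Their geometric mean is at most their arithmetic mean,
  the integral of \<open>\<psi>(z + a) (1 + 2 sinh\<^sup>2 z)\<close>, which \<open>sinh_moment_le\<close> controls.
\<close>
lemma cw_average_ratio_near_centre:
  fixes \<delta> K s :: real
  assumes "n < N"
  defines "c \<equiv> real (N - n)"
  assumes c: "2 \<le> c" and n: "(1 + \<delta>) * c \<le> real n" "real n \<le> K * c"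
    and s: "s\<^sup>2 \<le> 3 * c" and large: "4 + 64 * K + 486 * K\<^sup>2 \<le> \<delta> * c"
  shows "cw_average N n (s + 2) * cw_average N n (s - 2) \<le> (1 + 2 / c)\<^sup>2 * (cw_average N n s)\<^sup>2"
proof -
  have c0: "c > 0" using c by simp
  define a where "a = s / c"
  have s_eq: "s = c * a" using c0 by (simp add: a_def)
  have "a\<^sup>2 = s\<^sup>2 / c\<^sup>2" by (simp add: a_def power_divide)
  also have "\<dots> \<le> 3 * c / c\<^sup>2" by (intro divide_right_mono s) simp
  also have "\<dots> = 3 / c" using c0 by (simp add: power2_eq_square)
  finally have a: "a\<^sup>2 \<le> 3 / c" .
  define G E where "G = gauss_int (real N) (\<lambda>_. 1)" and "E = exp (c * a\<^sup>2 / 2)"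
  define P where "P = (\<lambda>t. gauss_int c (\<lambda>z. quartic_factor n (z + a) * exp (t * z)))"
  have G: "0 < G" unfolding G_def using assms(1) by (intro gauss_int_pos) (auto intro: exp_bounded_intros)
  have W: "cw_average N n (s + t) * G = E * exp (t * a) * P t" for t
    using cw_average_shift[OF assms(1), of a t] by (simp add: s_eq c_def G_def E_def P_def)
  have P0: "P 0 = gauss_int c (\<lambda>z. quartic_factor n (z + a))" by (simp add: P_def)
  have P_nonneg: "0 \<le> P t" for t
    unfolding P_def using c0
    by (intro less_imp_le[OF gauss_int_pos])
      (auto intro!: exp_bounded_intros exp_bounded_quartic_factor mult_pos_pos quartic_factor_pos)
  have "c * (P 2 + P (- 2)) \<le> 2 * c * P 0 + 4 * P 0"
    using gauss_int_two_sided_tilt[OF c0, of n a] sinh_moment_le[OF c n a large]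
    by (simp add: P_def algebra_simps)
  then have sum: "(P 2 + P (- 2)) / 2 \<le> (1 + 2 / c) * P 0"
    using c0 by (simp add: field_simps)
  have "(cw_average N n (s + 2) * G) * (cw_average N n (s + - 2) * G) = E\<^sup>2 * (P 2 * P (- 2))"
    unfolding W by (simp add: power2_eq_square exp_minus)
  also have "\<dots> \<le> E\<^sup>2 * ((P 2 + P (- 2)) / 2)\<^sup>2"
  proof (intro mult_left_mono)
    have "((P 2 + P (- 2)) / 2)\<^sup>2 - P 2 * P (- 2) = ((P 2 - P (- 2)) / 2)\<^sup>2"
      by (simp add: power2_eq_square field_simps)
    then show "P 2 * P (- 2) \<le> ((P 2 + P (- 2)) / 2)\<^sup>2" by (smt (verit) zero_le_power2)
  qed simp
  also have "\<dots> \<le> E\<^sup>2 * ((1 + 2 / c) * P 0)\<^sup>2"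
    using P_nonneg by (intro mult_left_mono power_mono sum) auto
  also have "\<dots> = (1 + 2 / c)\<^sup>2 * (cw_average N n (s + 0) * G)\<^sup>2"
    unfolding W by (simp add: power_mult_distrib)
  finally have "(cw_average N n (s + 2) * cw_average N n (s - 2)) * G\<^sup>2
      \<le> ((1 + 2 / c)\<^sup>2 * (cw_average N n s)\<^sup>2) * G\<^sup>2"
    by (simp add: power2_eq_square mult_ac)
  then show ?thesis using G by (simp add: mult_le_cancel_right)
qed

text \<open>
  Near the centre \<open>(1 + 2/k)\<^sup>2\<close> bounds the ratio of the \<open>w\<close>-values; for \<open>s\<^sup>2 > 3k\<close> the weaker bound
  \<open>exp (4/k) \<le> 1 + 4/k + 16/k\<^sup>2\<close> is compensated by \<open>4 s\<^sup>2 / k > 12\<close>, which is where the constant \<open>3\<close> comes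
  from.
\<close>
lemma log_concave_plus_prob_window:
  fixes \<delta> K :: real
  assumes k: "4 \<le> k" "k < N"
    and n: "(1 + \<delta>) * real k \<le> real (N - k)" "real (N - k) \<le> K * real k"
    and large: "4 + 64 * K + 486 * K\<^sup>2 \<le> \<delta> * real k"
  shows "log_concave_seq k (plus_prob N k)"
proof -
  define n where "n = N - k"
  have nN: "n < N" "N - n = k" using k by (auto simp: n_def)
  let ?w = "cw_average N n"
  define C where "C = 2 ^ n / cw_partition N"
  have C: "C > 0" using cw_partition_pos by (simp add: C_def)
  have p: "plus_prob N k j = C * (real (k choose j) * ?w (2 * real j - real k))" for j
    using k by (simp add: plus_prob_eq n_def C_def)
  define \<kappa> where "\<kappa> = real k"
  have \<kappa>: "4 \<le> \<kappa>" using k by (simp add: \<kappa>_def)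
  have ratio: "(\<kappa>\<^sup>2 - s\<^sup>2) * (?w (s + 2) * ?w (s - 2)) \<le> ((\<kappa> + 2)\<^sup>2 - s\<^sup>2) * (?w s)\<^sup>2"
    if s: "s\<^sup>2 \<le> \<kappa>\<^sup>2" for s
  proof -
    define R where "R = (if s\<^sup>2 \<le> 3 * \<kappa> then (1 + 2 / \<kappa>)\<^sup>2 else exp (4 / \<kappa>))"
    have "?w (s + 2) * ?w (s - 2) \<le> R * (?w s)\<^sup>2"
    proof (cases "s\<^sup>2 \<le> 3 * \<kappa>")
      case True
      then show ?thesis
        using cw_average_ratio_near_centre[OF nN(1), of \<delta> K s, unfolded nN(2), folded \<kappa>_def]
          \<kappa> n[folded n_def \<kappa>_def] large[folded \<kappa>_def]
        by (simp add: R_def)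
    next
      case False
      then show ?thesis
        using cw_average_ratio_le_exp[OF nN(1), of s] by (simp add: nN R_def \<kappa>_def)
    qed
    then have "(\<kappa>\<^sup>2 - s\<^sup>2) * (?w (s + 2) * ?w (s - 2)) \<le> (\<kappa>\<^sup>2 - s\<^sup>2) * (R * (?w s)\<^sup>2)"
      using s by (intro mult_left_mono) auto
    also have "\<dots> = ((\<kappa>\<^sup>2 - s\<^sup>2) * R) * (?w s)\<^sup>2" by simp
    also have "\<dots> \<le> ((\<kappa> + 2)\<^sup>2 - s\<^sup>2) * (?w s)\<^sup>2"
    proof (rule mult_right_mono)
      show "(\<kappa>\<^sup>2 - s\<^sup>2) * R \<le> (\<kappa> + 2)\<^sup>2 - s\<^sup>2"
      proof (cases "s\<^sup>2 \<le> 3 * \<kappa>")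
        case True
        have "\<kappa>\<^sup>2 * (1 + 2 / \<kappa>)\<^sup>2 = (\<kappa> + 2)\<^sup>2"
          using \<kappa> by (simp add: power2_eq_square field_simps)
        moreover have "s\<^sup>2 * 1 \<le> s\<^sup>2 * (1 + 2 / \<kappa>)\<^sup>2"
          using \<kappa> by (intro mult_left_mono one_le_power) auto
        ultimately show ?thesis using True by (simp add: R_def left_diff_distrib)
      next
        case False
        have "R \<le> 1 + 4 / \<kappa> + (4 / \<kappa>)\<^sup>2"
          using False \<kappa> exp_bound[of "4 / \<kappa>"] by (simp add: R_def)
        then have "(\<kappa>\<^sup>2 - s\<^sup>2) * R \<le> (\<kappa>\<^sup>2 - s\<^sup>2) * (1 + 4 / \<kappa> + (4 / \<kappa>)\<^sup>2)"
          using s by (intro mult_left_mono) auto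
        also have "\<dots> = \<kappa>\<^sup>2 + 4 * \<kappa> + 16 - s\<^sup>2 - 4 / \<kappa> * s\<^sup>2 - (4 / \<kappa>)\<^sup>2 * s\<^sup>2"
          using \<kappa> by (simp add: power2_eq_square field_simps)
        also have "\<dots> \<le> \<kappa>\<^sup>2 + 4 * \<kappa> + 16 - s\<^sup>2 - 12 - 0"
        proof (intro diff_mono order_refl)
          have "4 / \<kappa> * (3 * \<kappa>) \<le> 4 / \<kappa> * s\<^sup>2"
            using False \<kappa> by (intro mult_left_mono) auto
          then show "12 \<le> 4 / \<kappa> * s\<^sup>2" using \<kappa> by simp
        qed simp
        also have "\<dots> = (\<kappa> + 2)\<^sup>2 - s\<^sup>2" by (simp add: power2_eq_square algebra_simps)
        finally show ?thesis .
      qed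
    qed simp
    finally show ?thesis .
  qed
  have "plus_prob N k i * plus_prob N k (Suc (Suc i)) \<le> (plus_prob N k (Suc i))\<^sup>2" if i: "Suc i < k" for i
  proof -
    define j where "j = real (Suc i)"
    define s where "s = 2 * j - \<kappa>"
    define b0 b1 b2 where "b0 = real (k choose i)" "b1 = real (k choose Suc i)" "b2 = real (k choose Suc (Suc i))"
    note b_defs = this
    have j: "1 \<le> j" "j \<le> \<kappa> - 1" using i by (auto simp: j_def \<kappa>_def)
    have "(k - i) * (k choose i) = Suc i * (k choose Suc i)"
      "(k - Suc i) * (k choose Suc i) = Suc (Suc i) * (k choose Suc (Suc i))"
      using binomial_absorb_comp[of k] binomial_absorption[of _ k] by (metis mult.commute)+
    then have "real (k - i) * b0 = real (Suc i) * b1" "real (k - Suc i) * b1 = real (Suc (Suc i)) * b2"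
      unfolding b_defs of_nat_mult[symmetric] by simp_all
    then have b: "(\<kappa> - j + 1) * b0 = j * b1" "(j + 1) * b2 = (\<kappa> - j) * b1"
      using i by (simp_all add: j_def \<kappa>_def of_nat_diff algebra_simps)
    have sq: "4 * (j * (\<kappa> - j)) = \<kappa>\<^sup>2 - s\<^sup>2" "4 * ((\<kappa> - j + 1) * (j + 1)) = (\<kappa> + 2)\<^sup>2 - s\<^sup>2"
      by (simp_all add: s_def power2_eq_square algebra_simps)
    have "0 \<le> j * (\<kappa> - j)" using j by simp
    then have "s\<^sup>2 \<le> \<kappa>\<^sup>2" using sq(1) by linarith
    from ratio[OF this]
    have "j * (\<kappa> - j) * (?w (s + 2) * ?w (s - 2)) \<le> (\<kappa> - j + 1) * (j + 1) * (?w s)\<^sup>2"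
      unfolding sq[symmetric] by (simp only: mult.assoc mult_le_cancel_left)
    then have "b1\<^sup>2 * (j * (\<kappa> - j) * (?w (s + 2) * ?w (s - 2))) \<le> b1\<^sup>2 * ((\<kappa> - j + 1) * (j + 1) * (?w s)\<^sup>2)"
      by (intro mult_left_mono) auto
    also have "b1\<^sup>2 * (j * (\<kappa> - j) * (?w (s + 2) * ?w (s - 2)))
        = (j * b1) * ((\<kappa> - j) * b1) * (?w (s + 2) * ?w (s - 2))"
      by (simp add: power2_eq_square)
    also have "\<dots> = ((\<kappa> - j + 1) * (j + 1)) * ((b0 * ?w (s - 2)) * (b2 * ?w (s + 2)))"
      unfolding b[symmetric] by simp
    finally have "((\<kappa> - j + 1) * (j + 1)) * ((b0 * ?w (s - 2)) * (b2 * ?w (s + 2)))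
        \<le> ((\<kappa> - j + 1) * (j + 1)) * (b1 * ?w s)\<^sup>2"
      by (simp add: power_mult_distrib mult_ac)
    moreover have "0 < (\<kappa> - j + 1) * (j + 1)" using j by (intro mult_pos_pos) auto
    ultimately have main: "(b0 * ?w (s - 2)) * (b2 * ?w (s + 2)) \<le> (b1 * ?w s)\<^sup>2"
      by (simp only: mult_le_cancel_left_pos)
    have "plus_prob N k i = C * (b0 * ?w (s - 2))" "plus_prob N k (Suc i) = C * (b1 * ?w s)"
      "plus_prob N k (Suc (Suc i)) = C * (b2 * ?w (s + 2))"
      unfolding p b_defs by (simp_all add: s_def j_def \<kappa>_def algebra_simps)
    then show ?thesis
      using mult_left_mono[OF main, of "C\<^sup>2"] by (simp add: power2_eq_square mult_ac)
  qed
  then have "plus_prob N k (j - 1) * plus_prob N k (j + 1) \<le> (plus_prob N k j)\<^sup>2"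
    if "j \<in> {1..<k}" for j
    using that by (cases j) auto
  moreover have "0 < plus_prob N k j" if "j \<le> k" for j
    unfolding p using C that cw_average_pos by (intro mult_pos_pos) auto
  ultimately show ?thesis by (simp add: log_concave_seq_def)
qed

text \<open>
  The window length \<open>k\<^sub>0 = \<lfloor>c N\<rfloor>\<close> satisfies the hypotheses of \<open>log_concave_plus_prob_window\<close> once \<open>N\<close> is
  large, and thinning carries log-concavity down to every smaller \<open>k\<close>.
\<close>
lemma eventually_log_concave:
  fixes c :: real
  assumes c: "0 < c" "c < 1 / 2"
  shows "\<exists>N\<^sub>1. \<forall>N\<ge>N\<^sub>1. \<forall>k. real k \<le> c * real N \<longrightarrow> log_concave_seq k (plus_prob N k)"
proof -
  define \<delta> K where "\<delta> = (1 - 2 * c) / c" and "K = 2 / c"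
  define M where "M = 4 + (4 + 64 * K + 486 * K\<^sup>2) / \<delta>"
  have \<delta>: "0 < \<delta>" using c by (simp add: \<delta>_def)
  have K: "0 < K" using c by (simp add: K_def)
  have M: "4 \<le> M" using \<delta> K by (simp add: M_def)
  have "log_concave_seq k (plus_prob N k)"
    if N: "nat \<lceil>2 * M / c\<rceil> \<le> N" and k: "real k \<le> c * real N" for N k
  proof -
    define k\<^sub>0 where "k\<^sub>0 = nat \<lfloor>c * real N\<rfloor>"
    have cN: "0 \<le> c * real N" using c by simp
    have k0: "real k\<^sub>0 \<le> c * real N" "c * real N < real k\<^sub>0 + 1"
      unfolding k\<^sub>0_def using cN by linarith+
    have "2 * M / c \<le> real N" using N by linarith
    then have "2 * M \<le> c * real N" using c by (simp add: field_simps)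
    then have M0: "M \<le> real k\<^sub>0" and half: "c * real N \<le> 2 * real k\<^sub>0" using k0 M by linarith+
    have "0 < real N" using half M0 M c \<open>2 * M \<le> c * real N\<close> by (smt (verit) mult_nonneg_nonpos)
    then have "c * real N < 1 / 2 * real N" using c by (intro mult_strict_right_mono) auto
    then have kN: "k\<^sub>0 < N" using k0 \<open>0 < real N\<close> by linarith
    then have n: "real (N - k\<^sub>0) = real N - real k\<^sub>0" by (simp add: of_nat_diff)
    have "(1 + \<delta>) * real k\<^sub>0 = (1 - c) / c * real k\<^sub>0" using c by (simp add: \<delta>_def field_simps)
    also have "\<dots> \<le> (1 - c) / c * (c * real N)" using c k0 by (intro mult_left_mono) auto
    also have "\<dots> = real N - c * real N" using c by (simp add: field_simps)
    finally have n1: "(1 + \<delta>) * real k\<^sub>0 \<le> real (N - k\<^sub>0)" using n k0 by linarith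
    have "real N \<le> K * real k\<^sub>0" using half c by (simp add: K_def field_simps)
    then have n2: "real (N - k\<^sub>0) \<le> K * real k\<^sub>0" using n by linarith
    have "(4 + 64 * K + 486 * K\<^sup>2) / \<delta> \<le> real k\<^sub>0" using M0 by (simp add: M_def)
    then have "4 + 64 * K + 486 * K\<^sup>2 \<le> \<delta> * real k\<^sub>0" using \<delta> by (simp add: field_simps)
    moreover have "4 \<le> k\<^sub>0" using M M0 by linarith
    ultimately have "log_concave_seq k\<^sub>0 (plus_prob N k\<^sub>0)"
      using kN n1 n2 by (intro log_concave_plus_prob_window[of k\<^sub>0 N \<delta> K]) auto
    moreover have "k \<le> k\<^sub>0" unfolding k\<^sub>0_def using k by (simp add: le_nat_floor)
    ultimately show ?thesis using kN by (intro log_concave_plus_prob_downward[of k k\<^sub>0 N]) auto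
  qed
  then show ?thesis by blast
qed

section \<open>Failure of unimodality for windows longer than half\<close>

text \<open>
  Integrating \<open>y \<psi>(y)\<close> by parts rewrites \<open>\<integral> \<psi>\<close> as \<open>\<integral> \<psi> (c y\<^sup>2 + n y (y - tanh y))\<close>. Pointwise,
  \<open>c (sinh\<^sup>2 y - y\<^sup>2) - n y (y - tanh y)\<close> is at least \<open>(c - n) y\<^sup>4 / 3\<close>.
\<close>
lemma sinh_moment_gt:
  assumes "real n + 1 \<le> c"
  shows "gauss_int c (quartic_factor n) < c * gauss_int c (\<lambda>y. quartic_factor n y * (sinh y)\<^sup>2)"
proof -
  let ?Q = "quartic_factor n"
  have c: "c > 0" using assms by simp
  have Q: "exp_bounded ?Q" using exp_bounded_quartic_factor[of n 0] by simp
  have T: "exp_bounded tanh" using exp_bounded_tanh[of 0] by simp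
  note bnd = Q T exp_bounded_intros
  define F' where "F' = (\<lambda>y. ?Q y - real n * (y * (y - tanh y)) * ?Q y)"
  have F': "exp_bounded F'" unfolding F'_def by (intro bnd)
  have ibp: "gauss_int c F' = c * gauss_int c (\<lambda>y. y * (y * ?Q y))"
  proof (rule gauss_int_by_parts[OF c _ F'])
    show "exp_bounded (\<lambda>y. y * ?Q y)" by (intro bnd)
    show "((\<lambda>y. y * ?Q y) has_real_derivative F' y) (at y)" for y
      using DERIV_mult[OF DERIV_ident quartic_factor_deriv[of n y]]
      by (simp add: F'_def algebra_simps)
    show "continuous_on UNIV F'" unfolding F'_def by (intro continuous_intros) auto
  qed
  have quart: "exp_bounded (\<lambda>y. ?Q y * (1 / 3 * y ^ 4))" by (intro bnd)
  have "0 < gauss_int c (\<lambda>y. ?Q y * (1 / 3 * y ^ 4))"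
    by (intro gauss_int_pos[OF c quart] mult_pos_pos quartic_factor_pos) auto
  also have "\<dots> \<le> gauss_int c (\<lambda>y. (c * (?Q y * (sinh y)\<^sup>2) - ?Q y) + (F' y - c * (y * (y * ?Q y))))"
  proof (rule gauss_int_mono[OF c])
    fix y
    have "y ^ 4 / 3 \<le> (c - real n) * (y ^ 4 / 3)"
      using mult_right_mono[of 1 "c - real n" "y ^ 4 / 3"] assms by simp
    also have "\<dots> \<le> c * ((sinh y)\<^sup>2 - y\<^sup>2) - real n * (y * (y - tanh y))"
      unfolding left_diff_distrib using c sinh_square_ge[of y]
      by (intro diff_mono mult_left_mono tanh_defect_mult_le) auto
    finally have "?Q y * (y ^ 4 / 3) \<le> ?Q y * (c * ((sinh y)\<^sup>2 - y\<^sup>2) - real n * (y * (y - tanh y)))"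
      using quartic_factor_pos[of n y] by (intro mult_left_mono) auto
    then show "?Q y * (1 / 3 * y ^ 4) \<le> (c * (?Q y * (sinh y)\<^sup>2) - ?Q y) + (F' y - c * (y * (y * ?Q y)))"
      by (simp add: F'_def algebra_simps power2_eq_square)
  qed (unfold F'_def, (intro bnd)+)
  also have "\<dots> = (c * gauss_int c (\<lambda>y. ?Q y * (sinh y)\<^sup>2) - gauss_int c ?Q)
       + (gauss_int c F' - c * gauss_int c (\<lambda>y. y * (y * ?Q y)))"
    using c F' by (simp only: gauss_int_cmult gauss_int_diff gauss_int_add bnd)
  finally show ?thesis using ibp by simp
qed

text \<open>
  Since \<open>w\<close> is even, \<open>w(2)\<close> is itself the integral of \<open>\<psi>(y) (1 + 2 sinh\<^sup>2 y)\<close>, so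
  \<open>sinh_moment_gt\<close> applies directly.
\<close>
lemma cw_average_increase_at_centre:
  assumes "2 * n < N"
  shows "(1 + 2 / real (N - n)) * cw_average N n 0 < cw_average N n 2"
proof -
  have nN: "n < N" using assms by simp
  define c where "c = real (N - n)"
  have c0: "0 < c" using nN by (simp add: c_def)
  have cn: "real n + 1 \<le> c" unfolding c_def using assms by linarith
  define G where "G = gauss_int (real N) (\<lambda>_. 1)"
  have G: "0 < G" unfolding G_def using nN by (intro gauss_int_pos) (auto intro: exp_bounded_intros)
  define P where "P = (\<lambda>t. gauss_int c (\<lambda>z. quartic_factor n z * exp (t * z)))"
  have W: "cw_average N n t * G = P t" for t
    using cw_average_gauss[OF nN, of t] by (simp add: c_def G_def P_def)
  have "P (- 2) = P 2" using W[of "- 2"] W[of 2] cw_average_even[of N n 2] by simp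
  then have "P 2 = P 0 + 2 * gauss_int c (\<lambda>z. quartic_factor n z * (sinh z)\<^sup>2)"
    using gauss_int_two_sided_tilt[OF c0, of n 0] by (simp add: P_def)
  then have "c * P 2 = c * P 0 + 2 * (c * gauss_int c (\<lambda>z. quartic_factor n z * (sinh z)\<^sup>2))"
    by (simp add: algebra_simps)
  moreover have "P 0 < c * gauss_int c (\<lambda>z. quartic_factor n z * (sinh z)\<^sup>2)"
    using sinh_moment_gt[OF cn] by (simp add: P_def)
  ultimately have "c * P 0 + 2 * P 0 < c * P 2" by linarith
  then have "((1 + 2 / c) * cw_average N n 0) * G < cw_average N n 2 * G"
    unfolding mult.assoc W using c0 by (simp add: field_simps)
  then show ?thesis using G by (simp add: c_def mult_less_cancel_right)
qed

text \<open>
  For even \<open>k\<close> the entries \<open>k/2\<close> and \<open>k/2 + 1\<close> are compared. For odd \<open>k\<close> the two central entries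
  coincide, and the comparison of the next pair involves \<open>w(1)\<close> and \<open>w(3)\<close>. One more step of the walk
  turns these into \<open>w(0)\<close> and \<open>w(2)\<close> for a window of length \<open>k - 1\<close>, so the bound at the
  centre covers this case as well.
\<close>
lemma not_unimodal_plus_prob:
  assumes k: "k \<le> N" "2 \<le> k" and majority: "N + 2 < 2 * k"
  shows "\<not> unimodal_seq k (plus_prob N k)"
proof -
  define n where "n = N - k"
  have n: "N - n = k" using k by (simp add: n_def)
  define C where "C = 2 ^ n / cw_partition N"
  have C: "C > 0" using cw_partition_pos by (simp add: C_def)
  have p: "plus_prob N k j = C * (real (k choose j) * cw_average N n (2 * real j - real k))" for j
    using k by (simp add: plus_prob_eq n_def C_def)
  have rise: "plus_prob N k i < plus_prob N k (Suc i)"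
    if i: "i < k"
      and w: "(real i + 1) * cw_average N n (2 * real i - real k)
              < (real k - real i) * cw_average N n (2 * real i - real k + 2)" for i
  proof -
    define b b' where "b = real (k choose i)" and "b' = real (k choose Suc i)"
    have b: "0 < b" using i by (simp add: b_def)
    have "(k - i) * (k choose i) = Suc i * (k choose Suc i)"
      using binomial_absorb_comp[of k i] binomial_absorption[of i k] by (metis mult.commute)
    then have "real (k - i) * b = real (Suc i) * b'"
      unfolding b_def b'_def of_nat_mult[symmetric] by simp
    then have bb: "(real k - real i) * b = (real i + 1) * b'"
      using i by (simp add: of_nat_diff add.commute)
    have "(real i + 1) * (b * cw_average N n (2 * real i - real k))
        < ((real k - real i) * b) * cw_average N n (2 * real i - real k + 2)"
      using mult_strict_left_mono[OF w b] by (simp add: mult_ac)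
    also have "\<dots> = (real i + 1) * (b' * cw_average N n (2 * real i - real k + 2))"
      unfolding bb by simp
    finally have "b * cw_average N n (2 * real i - real k) < b' * cw_average N n (2 * real i - real k + 2)"
      by (simp add: mult_less_cancel_left_pos)
    then show ?thesis using C by (simp add: p b_def b'_def algebra_simps)
  qed
  show ?thesis
  proof (cases "even k")
    case True
    then obtain m where m: "k = 2 * m" by blast
    have "(1 + 2 / real k) * cw_average N n 0 < cw_average N n 2"
      using cw_average_increase_at_centre[of n N] majority k n by (simp add: n_def)
    then have "real m * ((1 + 2 / real k) * cw_average N n 0) < real m * cw_average N n 2"
      using m k by (intro mult_strict_left_mono) auto
    moreover have "real m * (1 + 2 / real k) = real m + 1" using m k by (simp add: field_simps)
    ultimately have "(real m + 1) * cw_average N n 0 < real m * cw_average N n 2"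
      by (metis mult.assoc)
    then have "plus_prob N k m < plus_prob N k (Suc m)"
      using m k by (intro rise) auto
    then show ?thesis
      using m k by (intro not_unimodal_if_increase_past_centre[of k _ m] plus_prob_symmetric) auto
  next
    case False
    then obtain m where m: "k = 2 * m + 1" by (metis oddE)
    have m0: "0 < m" using m k by auto
    have "(1 + 2 / real (N - Suc n)) * cw_average N (Suc n) 0 < cw_average N (Suc n) 2"
      using majority k by (intro cw_average_increase_at_centre) (auto simp: n_def)
    moreover have "N - Suc n = 2 * m" using n m by simp
    moreover have "cw_average N (Suc n) 0 = cw_average N n 1"
      using cw_average_even[of N n 1] by simp
    ultimately have "(1 + 1 / real m) * cw_average N n 1 < (cw_average N n 3 + cw_average N n 1) / 2"
      by (simp add: mult_ac)
    then have "real m * ((1 + 1 / real m) * cw_average N n 1)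
        < real m * ((cw_average N n 3 + cw_average N n 1) / 2)"
      using m0 by (intro mult_strict_left_mono) auto
    also have "real m * ((1 + 1 / real m) * cw_average N n 1) = (real m + 1) * cw_average N n 1"
      using m0 by (simp add: field_simps)
    finally have "(real m + 2) * cw_average N n 1 < real m * cw_average N n 3"
      by (simp add: algebra_simps)
    then have "plus_prob N k (Suc m) < plus_prob N k (Suc (Suc m))"
      using m m0 by (intro rise) (auto simp: add.commute)
    then show ?thesis
      using m m0 k by (intro not_unimodal_if_increase_past_centre[of k _ "Suc m"] plus_prob_symmetric) auto
  qed
qed

section \<open>The phase transition at half of the spins\<close>

theorem corollaryA2:
  fixes \<epsilon> :: real
  assumes "\<epsilon> > 0"
  shows "\<exists>N\<^sub>\<epsilon>::nat. \<forall>N\<ge>N\<^sub>\<epsilon>. \<forall>k::nat. 1 \<le> k \<and> k \<le> N \<longrightarrow>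
           (real k \<le> (1/2 - \<epsilon>) * real N \<longrightarrow>
              log_concave_seq k (plus_prob N k) \<and> unimodal_seq k (plus_prob N k)) \<and>
           (real k \<ge> (1/2 + \<epsilon>) * real N \<longrightarrow>
              \<not> unimodal_seq k (plus_prob N k))"
proof -
  have "\<exists>N\<^sub>1. \<forall>N\<ge>N\<^sub>1. \<forall>k\<ge>1. real k \<le> (1/2 - \<epsilon>) * real N
          \<longrightarrow> log_concave_seq k (plus_prob N k)"
  proof (cases "0 < 1/2 - \<epsilon>")
    case True
    then show ?thesis
      using eventually_log_concave[OF True] assms by auto
  next
    case False
    then have "(1/2 - \<epsilon>) * real N \<le> 0" for N
      by (intro mult_nonpos_nonneg) auto
    then have "\<not> real k \<le> (1/2 - \<epsilon>) * real N" if "1 \<le> k" for N k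
      using that by (metis not_one_le_zero of_nat_le_0_iff order_trans)
    then show ?thesis by blast
  qed
  then obtain N\<^sub>1 where N\<^sub>1: "\<And>N k. N\<^sub>1 \<le> N \<Longrightarrow> 1 \<le> k \<Longrightarrow> real k \<le> (1/2 - \<epsilon>) * real N
      \<Longrightarrow> log_concave_seq k (plus_prob N k)"
    by blast
  define N\<^sub>2 where "N\<^sub>2 = nat \<lceil>2 / \<epsilon>\<rceil> + 4"
  have large_k: "\<not> unimodal_seq k (plus_prob N k)"
    if "N\<^sub>2 \<le> N" "k \<le> N" and k: "(1/2 + \<epsilon>) * real N \<le> real k" for N k
  proof (rule not_unimodal_plus_prob)
    have "2 / \<epsilon> < real N" using that(1) unfolding N\<^sub>2_def by linarith
    then have "2 < \<epsilon> * real N" using assms by (simp add: field_simps)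
    then have "real N + 2 < 2 * real k" using k by (simp add: algebra_simps)
    then show maj: "N + 2 < 2 * k" by linarith
    then show "2 \<le> k" using that(1) by (simp add: N\<^sub>2_def)
  qed fact
  show ?thesis
  proof (intro exI[of _ "max N\<^sub>1 N\<^sub>2"] allI impI conjI)
    fix N k assume N: "max N\<^sub>1 N\<^sub>2 \<le> N" and k: "1 \<le> k \<and> k \<le> N"
    {
      assume "real k \<le> (1/2 - \<epsilon>) * real N"
      then show "log_concave_seq k (plus_prob N k)"
        using N\<^sub>1[of N k] N k by simp
      then show "unimodal_seq k (plus_prob N k)"
        by (rule log_concave_seq_imp_unimodal_seq)
    }
    assume "(1/2 + \<epsilon>) * real N \<le> real k"
    then show "\<not> unimodal_seq k (plus_prob N k)"
      using large_k[of N k] N k by simp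
  qed
qed

end
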